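(* Let $n\geqslant 1$ be an integer, $k\in[0,1)$, $\mu\geqslant\mu_0(k,n)$ and $p=p_1(k,n)$. Assume that $u_0\in H^1(\mathbb{R}^n)$ and $u_1\in L^2(\mathbb{R}^n)$ are nonnegative, nontrivial and compactly supported functions with supports contained in $B_R$ for some $R>0$. For $\varepsilon>0$, let $$u\in \mathcal{C}\big([1,T),H^1(\mathbb{R}^n)\big)\cap\mathcal{C}^1\big([1,T),L^2(\mathbb{R}^n)\big)\cap L^p_{\mathrm{loc}}\big([1,T)\times\mathbb{R}^n\big)$$ be an energy solution, with lifespan $T=T(\varepsilon)$, to the Cauchy problem $$u_{tt}-t^{-2k}\Delta u+\mu t^{-1}u_t=|u|^p \ \ (x\in\mathbb{R}^n,\ t\in(1,T)),\qquad u(1,x)=\varepsilon u_0(x),\quad u_t(1,x)=\varepsilon u_1(x),$$ satisfying the support condition $\mathrm{supp}\,u(t,\cdot)\subset B_{A_k(t)+R}$ for any $t\in(1,T)$. Then there exists a positive constant $\varepsilon_0=\varepsilon_0(u_0,u_1,n,p,k,\mu,R)$ such that for any $\varepsilon\in(0,\varepsilon_0]$ the energy solution $u$ blows up in finite time. Moreover, the upper bound estimate for the lifespan $$T(\varepsilon)\leqslant\exp\left(C\varepsilon^{-(p-1)}\right)$$ holds, where the positive constant $C$ is independent of $\varepsilon$.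
   Context: Notation: $B_r$ is the ball of radius $r$ centred at the origin of $\mathbb{R}^n$; $A_k(t)\doteq\int_1^t\tau^{-k}\,\mathrm{d}\tau=\frac{t^{1-k}-1}{1-k}$; $p_1(k,n)\doteq 1+\frac{2}{(1-k)n}$; and $$\mu_0(k,n)\doteq\frac{(1-k)^2n^2+(1-k)(1+2k)n+2}{n(1-k)+2}.$$ Energy solution: $u\in \mathcal{C}([1,T),H^1(\mathbb{R}^n))\cap\mathcal{C}^1([1,T),L^2(\mathbb{R}^n))\cap L^p_{\mathrm{loc}}([1,T)\times\mathbb{R}^n)$ is an energy solution on $[1,T)$ of the Cauchy problem if $u(1,\cdot)=\varepsilon u_0$ in $H^1(\mathbb{R}^n)$ and $$\int_{\mathbb{R}^n}\partial_tu(t,x)\psi(t,x)\,\mathrm{d}x-\varepsilon\int_{\mathbb{R}^n}u_1(x)\psi(1,x)\,\mathrm{d}x-\int_1^t\!\!\int_{\mathbb{R}^n}\partial_tu(s,x)\psi_s(s,x)\,\mathrm{d}x\,\mathrm{d}s+\int_1^t\!\!\int_{\mathbb{R}^n}s^{-2k}\nabla u(s,x)\cdot\nabla\psi(s,x)\,\mathrm{d}x\,\mathrm{d}s+\int_1^t\!\!\int_{\mathbb{R}^n}\mu s^{-1}\partial_tu(s,x)\psi(s,x)\,\mathrm{d}x\,\mathrm{d}s=\int_1^t\!\!\int_{\mathbb{R}^n}|u(s,x)|^p\psi(s,x)\,\mathrm{d}x\,\mathrm{d}s$$ for any $\psi\in\mathcal{C}_0^\infty([1,T)\times\mathbb{R}^n)$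 and any $t\in(1,T)$. The lifespan $T(\varepsilon)$ is the maximal time such that the solution exists on $[1,T(\varepsilon))$; blow-up in finite time means $T(\varepsilon)<\infty$. *)

theory Defs
  imports "HOL-Analysis.Analysis"
begin

section \<open>Test functions\<close>

primrec Ck_times_diff :: "nat \<Rightarrow> ('a::real_normed_vector \<Rightarrow> real) \<Rightarrow> bool" where
  "Ck_times_diff 0 f \<longleftrightarrow> continuous_on UNIV f"
| "Ck_times_diff (Suc m) f \<longleftrightarrow>
     (\<forall>x. f differentiable at x) \<and> (\<forall>v. Ck_times_diff m (\<lambda>x. frechet_derivative f (at x) v))"

definition smooth :: "('a::real_normed_vector \<Rightarrow> real) \<Rightarrow> bool" where
  "smooth f \<longleftrightarrow> (\<forall>m. Ck_times_diff m f)"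

definition test_fun :: "'a::real_normed_vector set \<Rightarrow> ('a \<Rightarrow> real) \<Rightarrow> bool" where
  "test_fun U \<phi> \<longleftrightarrow> smooth \<phi> \<and> compact (closure {x. \<phi> x \<noteq> 0}) \<and> closure {x. \<phi> x \<noteq> 0} \<subseteq> U"

definition grad :: "('a::euclidean_space \<Rightarrow> real) \<Rightarrow> 'a \<Rightarrow> 'a" where
  "grad \<phi> x = (\<Sum>b\<in>Basis. frechet_derivative \<phi> (at x) b *\<^sub>R b)"

section \<open>\<open>L\<^sup>2\<close> and \<open>H\<^sup>1\<close>\<close>

text \<open>Elements of \<open>L\<^sup>2\<close> and \<open>H\<^sup>1\<close> are represented by functions; almost everywhere equal
  functions are not identified, and the norms below are seminorms on representatives.\<close>

definition L2 :: "('a::euclidean_space \<Rightarrow> 'b::euclidean_space) set" where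
  "L2 = {f \<in> borel_measurable lebesgue. integrable lebesgue (\<lambda>x. (norm (f x))\<^sup>2)}"

definition L2_norm :: "('a::euclidean_space \<Rightarrow> 'b::euclidean_space) \<Rightarrow> real" where
  "L2_norm f = sqrt (LINT x|lebesgue. (norm (f x))\<^sup>2)"

definition has_weak_grad :: "('a::euclidean_space \<Rightarrow> real) \<Rightarrow> ('a \<Rightarrow> 'a) \<Rightarrow> bool" where
  "has_weak_grad f g \<longleftrightarrow> (\<forall>\<phi>. test_fun UNIV \<phi> \<longrightarrow>
     (LINT x|lebesgue. f x *\<^sub>R grad \<phi> x) = - (LINT x|lebesgue. \<phi> x *\<^sub>R g x))"

definition H1 :: "('a::euclidean_space \<Rightarrow> real) set" where
  "H1 = {f \<in> L2. \<exists>g \<in> L2. has_weak_grad f g}"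

text \<open>The weak gradient is determined up to a null set; this picks a representative.\<close>

definition weak_grad :: "('a::euclidean_space \<Rightarrow> real) \<Rightarrow> 'a \<Rightarrow> 'a" where
  "weak_grad f = (SOME g. g \<in> L2 \<and> has_weak_grad f g)"

definition H1_norm :: "('a::euclidean_space \<Rightarrow> real) \<Rightarrow> real" where
  "H1_norm f = sqrt ((L2_norm f)\<^sup>2 + (L2_norm (weak_grad f))\<^sup>2)"

definition ess_supp :: "('a::euclidean_space \<Rightarrow> real) \<Rightarrow> 'a set" where
  "ess_supp f = - \<Union>{U. open U \<and> (AE x in lebesgue. x \<in> U \<longrightarrow> f x = 0)}"

section \<open>Functions of time with values in function spaces\<close>

definition C_H1 :: "real set \<Rightarrow> (real \<Rightarrow> 'a::euclidean_space \<Rightarrow> real) \<Rightarrow> bool" where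
  "C_H1 I u \<longleftrightarrow> (\<forall>t\<in>I. u t \<in> H1 \<and>
     ((\<lambda>s. H1_norm (\<lambda>x. u s x - u t x)) \<longlongrightarrow> 0) (at t within I))"

definition C_L2 :: "real set \<Rightarrow> (real \<Rightarrow> 'a::euclidean_space \<Rightarrow> real) \<Rightarrow> bool" where
  "C_L2 I u \<longleftrightarrow> (\<forall>t\<in>I. u t \<in> L2 \<and>
     ((\<lambda>s. L2_norm (\<lambda>x. u s x - u t x)) \<longlongrightarrow> 0) (at t within I))"

text \<open>\<open>C1_L2 I u v\<close>: \<open>u\<close> belongs to \<open>C\<^sup>1(I, L\<^sup>2)\<close> and \<open>v\<close> is its time derivative
  (at every time unique up to a null set).\<close>

definition C1_L2 ::
  "real set \<Rightarrow> (real \<Rightarrow> 'a::euclidean_space \<Rightarrow> real) \<Rightarrow> (real \<Rightarrow> 'a \<Rightarrow> real) \<Rightarrow> bool" where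
  "C1_L2 I u v \<longleftrightarrow> C_L2 I u \<and> C_L2 I v \<and> (\<forall>t\<in>I.
     ((\<lambda>s. L2_norm (\<lambda>x. (u s x - u t x) / (s - t) - v t x)) \<longlongrightarrow> 0) (at t within I))"

text \<open>Membership in \<open>L\<^sup>p\<^sub>l\<^sub>o\<^sub>c(I \<times> \<real>\<^sup>n)\<close>; it includes joint measurability in time and space,
  which the choice of a representative for each single time does not provide.\<close>

definition Lp_loc :: "real \<Rightarrow> real set \<Rightarrow> (real \<Rightarrow> 'a::euclidean_space \<Rightarrow> real) \<Rightarrow> bool" where
  "Lp_loc p I u \<longleftrightarrow>
     (\<lambda>(t, x). u t x) \<in> borel_measurable (lebesgue_on (I \<times> UNIV)) \<and>
     (\<forall>K. compact K \<and> K \<subseteq> I \<times> UNIV \<longrightarrow>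
        integrable (lebesgue_on K) (\<lambda>(t, x). \<bar>u t x\<bar> powr p))"

section \<open>Energy solutions and lifespan\<close>

definition time_interval :: "ereal \<Rightarrow> real set" where
  "time_interval T = {t. 1 \<le> t \<and> ereal t < T}"

text \<open>The test functions in \<open>C\<^sub>0\<^sup>\<infinity>([1, T) \<times> \<real>\<^sup>n)\<close> need not vanish at time \<open>1\<close>; smoothness up to
  the boundary means being the restriction of a smooth function on \<open>\<real> \<times> \<real>\<^sup>n\<close>, and that
  extension can be taken with compact support in \<open>(-\<infinity>, T) \<times> \<real>\<^sup>n\<close>.\<close>

definition energy_solution ::
  "real \<Rightarrow> real \<Rightarrow> real \<Rightarrow> real \<Rightarrow> ('a::euclidean_space \<Rightarrow> real) \<Rightarrow> ('a \<Rightarrow> real) \<Rightarrow>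
   ereal \<Rightarrow> (real \<Rightarrow> 'a \<Rightarrow> real) \<Rightarrow> bool" where
  "energy_solution k \<mu> p \<epsilon> u0 u1 T u \<longleftrightarrow>
     1 < T \<and>
     C_H1 (time_interval T) u \<and>
     Lp_loc p (time_interval T) u \<and>
     (AE x in lebesgue. u 1 x = \<epsilon> * u0 x) \<and>
     (\<exists>ut. C1_L2 (time_interval T) u ut \<and>
        (\<forall>\<psi>. test_fun ({s. ereal s < T} \<times> UNIV) \<psi> \<longrightarrow>
          (\<forall>t. 1 < t \<and> ereal t < T \<longrightarrow>
             (LINT x|lebesgue. ut t x * \<psi> (t, x))
             - \<epsilon> * (LINT x|lebesgue. u1 x * \<psi> (1, x))
             - (LINT s:{1..t}|lebesgue. (LINT x|lebesgue. ut s x * deriv (\<lambda>r. \<psi> (r, x)) s))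
             + (LINT s:{1..t}|lebesgue. (LINT x|lebesgue.
                  s powr (-2 * k) * (weak_grad (u s) x \<bullet> grad (\<lambda>y. \<psi> (s, y)) x)))
             + (LINT s:{1..t}|lebesgue. (LINT x|lebesgue. \<mu> * s powr (-1) * ut s x * \<psi> (s, x)))
             = (LINT s:{1..t}|lebesgue. (LINT x|lebesgue. \<bar>u s x\<bar> powr p * \<psi> (s, x))))))"

text \<open>\<open>T\<close> is the lifespan of the solution \<open>u\<close>: the solution exists on \<open>[1, T)\<close> and cannot be
  continued as an energy solution beyond \<open>T\<close> (values of \<open>u\<close> at times \<open>t \<ge> T\<close> are irrelevant).\<close>

definition has_lifespan ::
  "real \<Rightarrow> real \<Rightarrow> real \<Rightarrow> real \<Rightarrow> ('a::euclidean_space \<Rightarrow> real) \<Rightarrow> ('a \<Rightarrow> real) \<Rightarrow>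
   (real \<Rightarrow> 'a \<Rightarrow> real) \<Rightarrow> ereal \<Rightarrow> bool" where
  "has_lifespan k \<mu> p \<epsilon> u0 u1 u T \<longleftrightarrow>
     energy_solution k \<mu> p \<epsilon> u0 u1 T u \<and>
     \<not> (\<exists>T' w. T < T' \<and> energy_solution k \<mu> p \<epsilon> u0 u1 T' w \<and>
          (\<forall>t\<in>time_interval T. AE x in lebesgue. w t x = u t x))"

section \<open>Parameters\<close>

definition A_fun :: "real \<Rightarrow> real \<Rightarrow> real" where
  "A_fun k t = integral {1..t} (\<lambda>\<tau>. \<tau> powr (-k))"

definition p1 :: "real \<Rightarrow> nat \<Rightarrow> real" where
  "p1 k n = 1 + 2 / ((1 - k) * real n)"

definition mu0 :: "real \<Rightarrow> nat \<Rightarrow> real" where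
  "mu0 k n = ((1 - k)\<^sup>2 * (real n)\<^sup>2 + (1 - k) * (1 + 2 * k) * real n + 2) / (real n * (1 - k) + 2)"

end

theory Submission
  imports Defs
begin

text \<open>The mean \<open>U t = (\<integral> u t x dx)\<close> obeys \<open>U'' + \<mu> U' / t = (\<integral> \<bar>u\<bar> powr p dx)\<close>: test the equation
  with a cutoff that is \<open>1\<close> on the light cone. By Hoelder's inequality on the ball of radius
  \<open>A_fun k t + R\<close>, whose volume is at most of order \<open>t powr ((1 - k) n)\<close>, the right-hand side is at
  least \<open>c \<bar>U\<bar> powr p / t\<^sup>2\<close> for the critical exponent \<open>p\<close>. In the variable \<open>ln t\<close> this is an
  autonomous differential inequality with damping \<open>\<mu> - 1\<close>, which is positive since \<open>\<mu> \<ge> mu0 k n > 1\<close>.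
  An explicit subsolution blowing up at logarithmic time of order \<open>\<epsilon> powr (-(p - 1))\<close> stays below
  \<open>U\<close>, so the lifespan cannot exceed its blow-up time.\<close>

section \<open>Smooth cutoff functions\<close>

text \<open>The mean is only once continuously differentiable: the weak formulation gives its
  equation in a form integrated from time \<open>1\<close>, so no differential inequality is
  available pointwise. The comparison is therefore run on integrated inequalities, and a first time
  at which the two derivatives meet is excluded by a Gronwall argument going backwards from it.
  Support information is at hand for \<open>u\<close> alone, not for its time derivative, which is
  therefore always paired with the spatial cutoff. Blow-up takes the form that no supersolution
  exists on the closed interval from \<open>1\<close> to the claimed bound: were \<open>T\<close>
  larger, possibly infinite, the mean would be bounded there by compactness, while the subsolution
  tends to infinity at the right end. The constant \<open>C\<close> is built from \<mu>,
  \<open>c\<close>, \<open>p\<close> and the two integrals of the data alone, so it is fixed before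
  \<epsilon>.\<close>

lemma Ck_times_diff_SucI:
  assumes "\<And>x. (f has_derivative D x) (at x)" and "\<And>v. Ck_times_diff m (\<lambda>x. D x v)"
  shows "Ck_times_diff (Suc m) f"
proof -
  have "frechet_derivative f (at x) = D x" for x
    using frechet_derivative_at[OF assms(1)[of x]] by simp
  with assms show ?thesis
    by (auto simp: differentiable_def)
qed

lemma Ck_times_diff_SucD:
  assumes "Ck_times_diff (Suc m) f"
  shows "(f has_derivative frechet_derivative f (at x)) (at x)"
    and "Ck_times_diff m (\<lambda>x. frechet_derivative f (at x) v)"
  using assms by (auto simp: frechet_derivative_works)

text \<open>The product, inverse and chain rules leave undifferentiated factors in the derivative;
  their inductions need those factors at one order less.\<close>

lemma Ck_times_diff_Suc_imp: "Ck_times_diff (Suc m) f \<Longrightarrow> Ck_times_diff m f"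
proof (induction m arbitrary: f)
  case 0
  then show ?case
    by (auto simp: continuous_on_eq_continuous_within intro: differentiable_imp_continuous_within)
next
  case (Suc m)
  then show ?case by (metis Ck_times_diff.simps(2))
qed

lemma Ck_times_diff_const: "Ck_times_diff m (\<lambda>x. c)"
proof (induction m arbitrary: c)
  case (Suc m)
  show ?case by (rule Ck_times_diff_SucI[where D = "\<lambda>_ _. 0"]) (auto intro: Suc)
qed auto

lemma Ck_times_diff_add:
  "Ck_times_diff m f \<Longrightarrow> Ck_times_diff m g \<Longrightarrow> Ck_times_diff m (\<lambda>x. f x + g x)"
proof (induction m arbitrary: f g)
  case (Suc m)
  show ?case
    by (rule Ck_times_diff_SucI)
      (rule has_derivative_add Suc Ck_times_diff_SucD[OF Suc.prems(1)]
        Ck_times_diff_SucD[OF Suc.prems(2)])+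
qed (auto intro: continuous_intros)

lemma Ck_times_diff_mult:
  "Ck_times_diff m f \<Longrightarrow> Ck_times_diff m g \<Longrightarrow> Ck_times_diff m (\<lambda>x. f x * g x)"
proof (induction m arbitrary: f g)
  case (Suc m)
  note D = Ck_times_diff_SucD[OF Suc.prems(1)] Ck_times_diff_SucD[OF Suc.prems(2)]
    Suc.prems[THEN Ck_times_diff_Suc_imp]
  show ?case
  proof (rule Ck_times_diff_SucI)
    show "((\<lambda>x. f x * g x) has_derivative
      (\<lambda>h. f x * frechet_derivative g (at x) h + frechet_derivative f (at x) h * g x)) (at x)" for x
      by (rule has_derivative_mult D)+
    show "Ck_times_diff m
      (\<lambda>x. f x * frechet_derivative g (at x) v + frechet_derivative f (at x) v * g x)" for v
      by (intro Ck_times_diff_add Suc.IH D)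
  qed
qed (auto intro: continuous_intros)

lemma Ck_times_diff_inverse:
  "Ck_times_diff m f \<Longrightarrow> (\<And>x. f x \<noteq> 0) \<Longrightarrow> Ck_times_diff m (\<lambda>x. inverse (f x))"
proof (induction m arbitrary: f)
  case (Suc m)
  note D = Ck_times_diff_SucD[OF Suc.prems(1)]
  have *: "Ck_times_diff m (\<lambda>x. inverse (f x))"
    by (intro Suc.IH Ck_times_diff_Suc_imp[OF Suc.prems(1)] Suc.prems(2))
  show ?case
  proof (rule Ck_times_diff_SucI)
    show "((\<lambda>x. inverse (f x)) has_derivative
      (\<lambda>h. (-1) * (inverse (f x) * frechet_derivative f (at x) h * inverse (f x)))) (at x)" for x
      using Deriv.has_derivative_inverse[OF Suc.prems(2) D(1)] by simp
    show "Ck_times_diff m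
      (\<lambda>x. (-1) * (inverse (f x) * frechet_derivative f (at x) v * inverse (f x)))" for v
      by (intro Ck_times_diff_mult Ck_times_diff_const D *)
  qed
qed (auto intro!: continuous_intros)

text \<open>A bounded linear map is its own derivative, so the direction \<open>L v\<close> does not
  depend on \<open>x\<close> and the induction closes without a product. With the projections as
  \<open>L\<close>, cutoffs in time and in space become smooth on space-time.\<close>

lemma Ck_times_diff_compose_linear:
  "Ck_times_diff m f \<Longrightarrow> bounded_linear L \<Longrightarrow> Ck_times_diff m (\<lambda>x. f (L x))"
proof (induction m arbitrary: f)
  case 0
  then show ?case
    by (auto intro: continuous_on_compose2 linear_continuous_on)
next
  case (Suc m)
  note D = Ck_times_diff_SucD[OF Suc.prems(1)]
  show ?case
  proof (rule Ck_times_diff_SucI)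
    show "((\<lambda>x. f (L x)) has_derivative (\<lambda>v. frechet_derivative f (at (L x)) (L v))) (at x)" for x
      by (rule has_derivative_compose[OF bounded_linear_imp_has_derivative[OF Suc.prems(2)] D(1)])
    show "Ck_times_diff m (\<lambda>x. frechet_derivative f (at (L x)) (L v))" for v
      by (rule Suc.IH[OF D(2) Suc.prems(2)])
  qed
qed

lemma Ck_times_diff_compose:
  fixes \<phi> :: "real \<Rightarrow> real"
  shows "Ck_times_diff m \<phi> \<Longrightarrow> Ck_times_diff m f \<Longrightarrow> Ck_times_diff m (\<lambda>x. \<phi> (f x))"
proof (induction m arbitrary: \<phi>)
  case 0
  then show ?case by (auto intro: continuous_on_compose2)
next
  case (Suc m)
  note D = Ck_times_diff_SucD[OF Suc.prems(1)] Ck_times_diff_SucD[OF Suc.prems(2)]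
    Suc.prems[THEN Ck_times_diff_Suc_imp]
  \<comment> \<open>\<open>Ck_times_diff\<close> controls derivatives in a fixed direction, but the
    chain rule produces a direction that varies with \<open>x\<close>. In one dimension, linearity
    turns this into a product with the derivative in direction \<open>1\<close>.\<close>
  have lin: "frechet_derivative \<phi> (at y) h = frechet_derivative \<phi> (at y) 1 * h" for y h
    using linear_cmul[OF has_derivative_linear[OF D(1)], of y h 1] by simp
  show ?case
  proof (rule Ck_times_diff_SucI)
    show "((\<lambda>x. \<phi> (f x)) has_derivative
      (\<lambda>v. frechet_derivative \<phi> (at (f x)) 1 * frechet_derivative f (at x) v)) (at x)" for x
      using has_derivative_compose[OF D(3) D(1), of x] lin[of "f x", symmetric] by (simp only:)
    show "Ck_times_diff m
      (\<lambda>x. frechet_derivative \<phi> (at (f x)) 1 * frechet_derivative f (at x) v)" for v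
      by (rule Ck_times_diff_mult[OF Suc.IH[OF D(2) D(6)] D(4)])
  qed
qed

lemma Ck_times_diff_bounded_linear:
  assumes "bounded_linear L" shows "Ck_times_diff m L"
proof (cases m)
  case 0
  then show ?thesis using assms by (auto intro: linear_continuous_on)
next
  case (Suc m')
  then show ?thesis
    using Ck_times_diff_SucI[of L "\<lambda>_. L"] bounded_linear_imp_has_derivative[OF assms]
      Ck_times_diff_const by metis
qed

lemma Ck_times_diff_norm_square: "Ck_times_diff m (\<lambda>x::'a::real_inner. x \<bullet> x)"
proof (cases m)
  case 0
  then show ?thesis by (auto intro: continuous_intros)
next
  case (Suc m')
  have "((\<lambda>x::'a. x \<bullet> x) has_derivative (\<lambda>v. 2 * (x \<bullet> v))) (at x)" for x
    by (auto intro!: derivative_eq_intros simp: inner_commute)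
  then show ?thesis
    unfolding Suc
    by (rule Ck_times_diff_SucI)
      (intro Ck_times_diff_mult Ck_times_diff_const Ck_times_diff_bounded_linear
        bounded_linear_inner_left)
qed

text \<open>The free power \<open>y ^ j\<close> makes the induction work: splitting off the constant
  coefficient leaves the smaller polynomial multiplied by one more factor \<open>y\<close>.\<close>

lemma tendsto_poly_mult_exp_minus:
  "((\<lambda>y::real. y ^ j * poly p y * exp (- y)) \<longlongrightarrow> 0) at_top"
proof (induction p arbitrary: j)
  case (pCons a p)
  have "((\<lambda>y. a * (y ^ j / exp y) + y ^ Suc j * poly p y * exp (- y)) \<longlongrightarrow> a * 0 + 0) at_top"
    by (intro tendsto_intros tendsto_power_div_exp_0 pCons)
  then show ?case by (simp add: exp_minus divide_inverse algebra_simps)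
qed simp

text \<open>The functions \<open>P (1/x) exp (-1/x)\<close>, extended by \<open>0\<close> to \<open>x \<le> 0\<close>, form a family closed under
  differentiation; this makes \<open>exp (-1/x)\<close> smooth at \<open>0\<close>.\<close>

definition exp_inv_poly :: "real poly \<Rightarrow> real \<Rightarrow> real" where
  "exp_inv_poly p x = (if 0 < x then poly p (inverse x) * exp (- inverse x) else 0)"

text \<open>With \<open>y = 1/x\<close> the derivative in \<open>x\<close> is \<open>- y^2\<close>
  times the derivative in \<open>y\<close>, which sends \<open>P(y) exp(-y)\<close> to
  \<open>y^2 (P - P')(y) exp(-y)\<close>. At the origin the right difference quotient is
  \<open>y P(y) exp(-y)\<close> as \<open>y\<close> tends to infinity, and the exponential
  wins.\<close>

lemma DERIV_exp_inv_poly: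
  "(exp_inv_poly p has_real_derivative exp_inv_poly ([:0, 0, 1:] * (p - pderiv p)) x) (at x)"
proof -
  consider "x > 0" | "x < 0" | "x = 0" by linarith
  then show ?thesis
  proof cases
    case 1
    have "((\<lambda>x. poly p (inverse x) * exp (- inverse x)) has_real_derivative
      exp_inv_poly ([:0, 0, 1:] * (p - pderiv p)) x) (at x)"
      using 1 unfolding exp_inv_poly_def
      by (auto intro!: derivative_eq_intros DERIV_chain2[OF poly_DERIV]
          simp: field_simps power2_eq_square)
    then show ?thesis
      by (rule has_field_derivative_transform_within_open[where S = "{0<..}"])
        (use 1 in \<open>auto simp: exp_inv_poly_def\<close>)
  next
    case 2
    have "((\<lambda>x. 0) has_real_derivative exp_inv_poly ([:0, 0, 1:] * (p - pderiv p)) x) (at x)"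
      using 2 by (simp add: exp_inv_poly_def)
    then show ?thesis
      by (rule has_field_derivative_transform_within_open[where S = "{..<0}"])
        (use 2 in \<open>auto simp: exp_inv_poly_def\<close>)
  next
    case 3
    have "((\<lambda>h. exp_inv_poly p h / h) \<longlongrightarrow> 0) (at_right 0)"
    proof (subst filterlim_at_right_to_top, rule Lim_transform_eventually)
      show "((\<lambda>y::real. y ^ 1 * poly p y * exp (- y)) \<longlongrightarrow> 0) at_top"
        by (rule tendsto_poly_mult_exp_minus)
      show "\<forall>\<^sub>F y in at_top. y ^ 1 * poly p y * exp (- y)
          = exp_inv_poly p (inverse y) / inverse y"
        using eventually_gt_at_top[of 0]
        by eventually_elim (auto simp: exp_inv_poly_def field_simps)
    qed
    moreover have "((\<lambda>h. exp_inv_poly p h / h) \<longlongrightarrow> 0) (at_left 0)"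
    proof (rule Lim_transform_eventually)
      show "((\<lambda>_. 0) \<longlongrightarrow> 0) (at_left (0::real))" by simp
      show "\<forall>\<^sub>F h in at_left 0. 0 = exp_inv_poly p h / h"
        by (rule eventually_at_leftI[of "-1"]) (auto simp: exp_inv_poly_def)
    qed
    ultimately have "((\<lambda>h. exp_inv_poly p h / h) \<longlongrightarrow> 0) (at 0)"
      by (simp add: filterlim_split_at)
    then show ?thesis
      using 3 by (simp add: DERIV_def exp_inv_poly_def)
  qed
qed

lemma Ck_times_diff_exp_inv_poly: "Ck_times_diff m (exp_inv_poly p)"
proof (induction m arbitrary: p)
  case 0
  have "isCont (exp_inv_poly p) x" for x
    by (rule DERIV_isCont[OF DERIV_exp_inv_poly])
  then show ?case by (simp add: continuous_on_eq_continuous_at)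
next
  case (Suc m)
  show ?case
    by (rule Ck_times_diff_SucI)
      (rule DERIV_exp_inv_poly[THEN has_field_derivative_imp_has_derivative]
        Ck_times_diff_mult Suc Ck_times_diff_const)+
qed

text \<open>The quotient of \<open>e (b - x)\<close> by \<open>e (b - x) + e (x - a)\<close> does
  it, with \<open>e\<close> flat at \<open>0\<close>: because \<open>a < b\<close>, at every
  \<open>x\<close> at least one of the two terms is positive, so the denominator never
  vanishes.\<close>

lemma smooth_step:
  fixes a b :: real
  assumes "a < b"
  obtains \<beta> where "smooth \<beta>" "\<And>x. 0 \<le> \<beta> x" "\<And>x. \<beta> x \<le> 1"
    "\<And>x. x \<le> a \<Longrightarrow> \<beta> x = 1" "\<And>x. b \<le> x \<Longrightarrow> \<beta> x = 0"
proof -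
  define e where "e = exp_inv_poly 1"
  have e: "e x \<ge> 0" "x > 0 \<Longrightarrow> e x > 0" "x \<le> 0 \<Longrightarrow> e x = 0" for x
    by (auto simp: e_def exp_inv_poly_def)
  have pos: "e (b - x) + e (x - a) > 0" for x
    using e(1)[of "b - x"] e(1)[of "x - a"] e(2)[of "b - x"] e(2)[of "x - a"] assms
    by (cases "x < b") auto
  \<comment> \<open>Differences and the quotient are spelled out as sums, products and an inverse,
    the shapes covered by the closure rules.\<close>
  define \<beta> where "\<beta> x = e (b + (-1) * x) * inverse (e (b + (-1) * x) + e (x + (- a)))" for x
  have "smooth \<beta>"
    unfolding smooth_def
  proof
    fix m
    have "Ck_times_diff m (\<lambda>x. e (b + (-1) * x))" "Ck_times_diff m (\<lambda>x. e (x + (- a)))"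
      unfolding e_def
      by (intro Ck_times_diff_compose[OF Ck_times_diff_exp_inv_poly] Ck_times_diff_add
          Ck_times_diff_mult Ck_times_diff_const Ck_times_diff_bounded_linear bounded_linear_ident)+
    then show "Ck_times_diff m \<beta>"
      unfolding \<beta>_def using pos
      by (intro Ck_times_diff_mult Ck_times_diff_inverse Ck_times_diff_add)
        (auto simp: less_imp_neq[symmetric])
  qed
  moreover have "0 \<le> \<beta> x" "\<beta> x \<le> 1" for x
    using e(1)[of "b - x"] e(1)[of "x - a"] pos[of x]
    by (auto simp: \<beta>_def field_simps)
  moreover have "\<beta> x = 1" if "x \<le> a" for x
    using e(2)[of "b - x"] e(3)[of "x - a"] that assms by (auto simp: \<beta>_def)
  moreover have "\<beta> x = 0" if "b \<le> x" for x
    using e(3)[of "b - x"] that by (auto simp: \<beta>_def)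
  ultimately show ?thesis using that by blast
qed

text \<open>The step is composed with the squared norm, since the norm itself is not smooth at the
  origin.\<close>

lemma smooth_cutoff:
  fixes r1 r2 :: real
  assumes "0 < r1" "r1 < r2"
  obtains \<zeta> :: "'a::real_inner \<Rightarrow> real" where "smooth \<zeta>" "\<And>x. 0 \<le> \<zeta> x" "\<And>x. \<zeta> x \<le> 1"
    "\<And>x. norm x \<le> r1 \<Longrightarrow> \<zeta> x = 1" "\<And>x. r2 \<le> norm x \<Longrightarrow> \<zeta> x = 0"
proof -
  have "r1\<^sup>2 < r2\<^sup>2" using assms by (simp add: power_strict_mono)
  then obtain \<beta> where \<beta>: "smooth \<beta>" "\<And>x. 0 \<le> \<beta> x" "\<And>x. \<beta> x \<le> 1"
    "\<And>x. x \<le> r1\<^sup>2 \<Longrightarrow> \<beta> x = 1" "\<And>x. r2\<^sup>2 \<le> x \<Longrightarrow> \<beta> x = 0"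
    using smooth_step by blast
  show ?thesis
  proof (rule that[of "\<lambda>x. \<beta> (x \<bullet> x)"])
    show "smooth (\<lambda>x::'a. \<beta> (x \<bullet> x))"
      using \<beta>(1) unfolding smooth_def
      by (blast intro: Ck_times_diff_compose[OF _ Ck_times_diff_norm_square])
  qed (use assms \<beta> in \<open>auto simp: power2_norm_eq_inner[symmetric]\<close>)
qed

lemma smooth_frechet_derivative:
  "smooth f \<Longrightarrow> smooth (\<lambda>x. frechet_derivative f (at x) v)"
  unfolding smooth_def using Ck_times_diff.simps(2) by blast

lemma smooth_continuous_on: "smooth f \<Longrightarrow> continuous_on S f"
  unfolding smooth_def using Ck_times_diff.simps(1) continuous_on_subset by blast

section \<open>A differential inequality with scale-invariant damping\<close>

text \<open>On a last piece of length \<open>d\<close> with \<open>\<mu> * d < 1\<close>, let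
  \<open>s\<close> be a point where \<open>f\<close> is maximal. As \<open>r \<ge> 1\<close>, the
  integral is at most \<open>d * f s\<close>, so the inequality at \<open>s\<close> gives
  \<open>f s \<le> \<mu> * d * f s < f s\<close>.\<close>

lemma backward_gronwall_contradiction:
  fixes f :: "real \<Rightarrow> real"
  assumes "1 < T" and cont: "continuous_on {1..T} f" and "0 \<le> \<mu>"
    and pos: "\<And>t. 1 \<le> t \<Longrightarrow> t < T \<Longrightarrow> 0 < f t" and "f T \<le> 0"
    and le: "\<And>s. 1 < s \<Longrightarrow> s < T \<Longrightarrow> f s \<le> f T + \<mu> * integral {s..T} (\<lambda>r. f r / r)"
  shows False
proof -
  \<comment> \<open>The first bound keeps the piece inside \<open>(1, T)\<close>, where the
    inequality is assumed; the second gives \<open>\<mu> * d < 1\<close>, also when \<mu> is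
    zero.\<close>
  define d where "d = min ((T - 1) / 2) (1 / (2 * (\<mu> + 1)))"
  have d: "0 < d" "d < T - 1" "\<mu> * d < 1"
    using assms(1,3) by (auto simp: d_def min_def field_simps)
  have "continuous_on {T - d..T} f"
    using d by (intro continuous_on_subset[OF cont]) auto
  then obtain s where s: "s \<in> {T - d..T}" "\<And>r. r \<in> {T - d..T} \<Longrightarrow> f r \<le> f s"
    using continuous_attains_sup[of "{T - d..T}" f] d by auto
  have "0 < f (T - d)" using d by (intro pos) auto
  then have fs: "0 < f s" using s(2)[of "T - d"] d by auto
  then have "s < T" using s(1) \<open>f T \<le> 0\<close> by (cases "s = T") auto
  have "integral {s..T} (\<lambda>r. f r / r) \<le> integral {s..T} (\<lambda>r. f s)"
  proof (rule integral_le)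
    show "(\<lambda>r. f r / r) integrable_on {s..T}"
      using s(1) d by (intro integrable_continuous_real continuous_intros continuous_on_subset[OF cont]) auto
    show "f r / r \<le> f s" if "r \<in> {s..T}" for r
    proof -
      have "f r \<le> f s" "1 \<le> r" using that s(1) s(2)[of r] d by auto
      moreover have "f s * 1 \<le> f s * r" using fs \<open>1 \<le> r\<close> by (intro mult_left_mono) auto
      ultimately have "f r \<le> f s * r" by linarith
      then show ?thesis using \<open>1 \<le> r\<close> by (simp add: divide_le_eq)
    qed
  qed (rule integrable_const_ivl)
  also have "\<dots> = (T - s) * f s" using \<open>s < T\<close> by simp
  also have "\<dots> \<le> d * f s" using s(1) fs by (intro mult_right_mono) auto
  finally have "\<mu> * integral {s..T} (\<lambda>r. f r / r) \<le> \<mu> * (d * f s)"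
    using \<open>0 \<le> \<mu>\<close> by (intro mult_left_mono) auto
  moreover have "\<mu> * d * f s < 1 * f s" using d(3) fs by (intro mult_strict_right_mono)
  ultimately have "\<mu> * integral {s..T} (\<lambda>r. f r / r) < f s" by simp
  then show False using le[of s] \<open>s < T\<close> s(1) d \<open>f T \<le> 0\<close> by auto
qed

text \<open>While \<open>V\<close> exceeds \<open>w'\<close>, the gap \<open>U - w\<close> cannot
  shrink, so the nonlinear term of \<open>U\<close> dominates that of \<open>w\<close>. Subtracting
  the two integrated inequalities then leaves a linear Gronwall inequality for
  \<open>V - w'\<close>, which forbids a first contact of the derivatives.\<close>

lemma damped_comparison:
  fixes U V w w' w'' :: "real \<Rightarrow> real"
  assumes "0 \<le> \<mu>" "0 \<le> c" "0 \<le> p"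
    and U: "\<And>t. t \<in> {1..<T} \<Longrightarrow> (U has_real_derivative V t) (at t within {1..<T})"
    and V: "continuous_on {1..<T} V"
    and w: "\<And>t. t \<in> {1..<T} \<Longrightarrow> (w has_real_derivative w' t) (at t within {1..<T})"
    and w': "\<And>t. t \<in> {1..<T} \<Longrightarrow> (w' has_real_derivative w'' t) (at t within {1..<T})"
    and w0: "\<And>t. t \<in> {1..<T} \<Longrightarrow> 0 \<le> w t"
    and sub: "\<And>t. t \<in> {1..<T} \<Longrightarrow> w'' t + \<mu> * w' t / t \<le> c / t\<^sup>2 * w t powr p"
    and super: "\<And>s t. 1 < s \<Longrightarrow> s < t \<Longrightarrow> t < T \<Longrightarrow>
      integral {s..t} (\<lambda>r. c / r\<^sup>2 * \<bar>U r\<bar> powr p) \<le> V t - V s + \<mu> * integral {s..t} (\<lambda>r. V r / r)"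
    and init: "w 1 < U 1" "w' 1 < V 1"
    and t: "t \<in> {1..<T}"
  shows "w t < U t"
proof -
  have w'_cont: "continuous_on {1..<T} w'"
    by (rule DERIV_continuous_on[OF w'])
  have w_cont: "continuous_on {1..<T} w" by (rule DERIV_continuous_on[OF w])
  have U_cont: "continuous_on {1..<T} U" by (rule DERIV_continuous_on[OF U])
  \<comment> \<open>The order of the derivatives is required strictly before \<open>b\<close> only,
    yet \<open>b\<close> is included in the conclusion; thus it can be used at the first contact
    time itself.\<close>
  have incr: "w b < U b" if pos: "\<And>r. 1 \<le> r \<Longrightarrow> r < b \<Longrightarrow> w' r < V r" and b: "b \<in> {1..<T}" for b
  proof -
    have "U 1 - w 1 \<le> U b - w b"
    proof (rule DERIV_nonneg_imp_increasing_open[where f = "\<lambda>r. U r - w r"])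
      show "1 \<le> b" using b by simp
      show "continuous_on {1..b} (\<lambda>r. U r - w r)"
        using b by (intro continuous_intros continuous_on_subset[OF U_cont] continuous_on_subset[OF w_cont]) auto
      fix r assume r: "1 < r" "r < b"
      then have "((\<lambda>r. U r - w r) has_real_derivative V r - w' r) (at r within {1..<T})"
        using b by (intro DERIV_diff U w) auto
      then have "((\<lambda>r. U r - w r) has_real_derivative V r - w' r) (at r)"
        using r b by (subst (asm) at_within_interior) (auto simp: interior_atLeastLessThan)
      then show "\<exists>y. ((\<lambda>r. U r - w r) has_real_derivative y) (at r) \<and> 0 \<le> y"
        using pos[of r] r by (intro exI[of _ "V r - w' r"]) auto
    qed
    with init(1) show ?thesis by simp
  qed
  have "w' b < V b" if b: "b \<in> {1..<T}" for b
  proof (rule ccontr)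
    assume "\<not> w' b < V b"
    \<comment> \<open>The contact set is closed, so its infimum \<open>t1\<close> belongs to it and
      is the first contact; the strict initial inequality puts it after \<open>1\<close>.\<close>
    define S where "S = {r \<in> {1..b}. V r - w' r \<le> 0}"
    have cont: "continuous_on {1..b} (\<lambda>r. V r - w' r)"
      using b by (intro continuous_intros continuous_on_subset[OF V] continuous_on_subset[OF w'_cont]) auto
    have "closed S"
      using continuous_closed_preimage[OF cont closed_atLeastAtMost, of "{..0}"]
      by (simp add: S_def vimage_def Int_def)
    moreover have "S \<noteq> {}" using \<open>\<not> w' b < V b\<close> b by (auto simp: S_def intro!: exI[of _ b])
    moreover have bdd: "bdd_below S" by (auto simp: S_def bdd_below_def)
    ultimately have "Inf S \<in> S" by (intro closed_contains_Inf)
    define t1 where "t1 = Inf S"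
    have t1: "t1 \<in> {1..b}" "V t1 - w' t1 \<le> 0"
      using \<open>Inf S \<in> S\<close> by (auto simp: S_def t1_def)
    have before: "w' r < V r" if "1 \<le> r" "r < t1" for r
    proof (rule ccontr)
      assume "\<not> w' r < V r"
      then have "r \<in> S" using that t1 by (auto simp: S_def)
      then show False using cInf_lower[OF _ bdd, of r] that by (simp add: t1_def)
    qed
    have "1 < t1" using t1 init(2) by (cases "t1 = 1") auto
    show False
    proof (rule backward_gronwall_contradiction[OF \<open>1 < t1\<close> _ \<open>0 \<le> \<mu>\<close>])
      show "continuous_on {1..t1} (\<lambda>r. V r - w' r)"
        using t1 by (intro continuous_on_subset[OF cont]) auto
      fix s assume s: "1 < s" "s < t1"
      have sub_st: "{s..t1} \<subseteq> {1..<T}" using s t1 b by auto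
      note conts = continuous_on_subset[OF V sub_st] continuous_on_subset[OF w'_cont sub_st]
        continuous_on_subset[OF w_cont sub_st] continuous_on_subset[OF U_cont sub_st]
      have i1: "(\<lambda>r. V r / r) integrable_on {s..t1}" "(\<lambda>r. w' r / r) integrable_on {s..t1}"
        using s by (intro integrable_continuous_real continuous_intros conts; force)+
      have wU: "w r < U r" "0 \<le> w r" if "r \<in> {s..t1}" for r
        using that before t1 b s by (auto intro!: incr w0)
      \<comment> \<open>Up to \<open>t1\<close> the mean stays above \<open>w \<ge> 0\<close>, so
        the base of the power does not vanish and the integrand is continuous.\<close>
      then have "\<forall>r\<in>{s..t1}. \<bar>U r\<bar> \<noteq> 0" by force
      then have i2: "(\<lambda>r. c / r\<^sup>2 * \<bar>U r\<bar> powr p) integrable_on {s..t1}"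
        using s by (intro integrable_continuous_real continuous_intros conts) auto
      have "(w'' has_integral w' t1 - w' s) {s..t1}"
      proof (rule fundamental_theorem_of_calculus)
        show "s \<le> t1" using s by simp
        show "(w' has_vector_derivative w'' r) (at r within {s..t1})" if "r \<in> {s..t1}" for r
          using has_field_derivative_subset[OF w' sub_st, of r] that sub_st
          by (auto simp: has_real_derivative_iff_has_vector_derivative)
      qed
      then have i3: "w'' integrable_on {s..t1}" "integral {s..t1} w'' = w' t1 - w' s"
        by (auto simp: has_integral_integrable integral_unique)
      \<comment> \<open>The subsolution inequality is weakened from \<open>w\<close> to
        \<open>U\<close> under the integral, which is where \<open>0 \<le> w \<le> U\<close> and the
        monotonicity of the power enter.\<close>
      have "integral {s..t1} (\<lambda>r. w'' r + \<mu> * (w' r / r)) \<le> integral {s..t1} (\<lambda>r. c / r\<^sup>2 * \<bar>U r\<bar> powr p)"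
      proof (rule integral_le)
        show "(\<lambda>r. w'' r + \<mu> * (w' r / r)) integrable_on {s..t1}"
          using i1 i3 by (intro integrable_add integrable_on_mult_right)
        fix r assume r: "r \<in> {s..t1}"
        then have "w r powr p \<le> \<bar>U r\<bar> powr p"
          using wU[of r] \<open>0 \<le> p\<close> by (intro powr_mono2) auto
        then have "c / r\<^sup>2 * w r powr p \<le> c / r\<^sup>2 * \<bar>U r\<bar> powr p"
          using \<open>0 \<le> c\<close> by (intro mult_left_mono) auto
        with sub[of r] r sub_st show "w'' r + \<mu> * (w' r / r) \<le> c / r\<^sup>2 * \<bar>U r\<bar> powr p" by auto
      qed (rule i2)
      also have "\<dots> \<le> V t1 - V s + \<mu> * integral {s..t1} (\<lambda>r. V r / r)"
        using s t1 b by (intro super) auto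
      also have "integral {s..t1} (\<lambda>r. w'' r + \<mu> * (w' r / r))
          = w' t1 - w' s + \<mu> * integral {s..t1} (\<lambda>r. w' r / r)"
        using integral_add[OF i3(1) integrable_on_mult_right[OF i1(2), of \<mu>]] i3(2)
        by (simp only: integral_mult_right)
      finally show "V s - w' s \<le> V t1 - w' t1 + \<mu> * integral {s..t1} (\<lambda>r. (V r - w' r) / r)"
        using i1 by (simp add: diff_divide_distrib integral_diff algebra_simps)
    qed (use before t1 in auto)
  qed
  then show ?thesis using t by (intro incr) auto
qed

text \<open>This is \<open>U'' + \<mu> U' / t \<ge> c \<bar>U\<bar>^p / t^2\<close> with
  \<open>V\<close> for \<open>U'\<close>, integrated over \<open>[s, t]\<close> because
  \<open>V\<close> is merely continuous. The interval includes \<open>T\<close>, so \<open>U\<close>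
  is bounded up to the end.\<close>

definition damped_supersolution ::
  "real \<Rightarrow> real \<Rightarrow> real \<Rightarrow> real \<Rightarrow> (real \<Rightarrow> real) \<Rightarrow> (real \<Rightarrow> real) \<Rightarrow> bool" where
  "damped_supersolution \<mu> c p T U V \<longleftrightarrow>
     (\<forall>t\<in>{1..T}. (U has_real_derivative V t) (at t within {1..T})) \<and> continuous_on {1..T} V \<and>
     (\<forall>s t. 1 < s \<and> s < t \<and> t < T \<longrightarrow>
        integral {s..t} (\<lambda>r. c / r\<^sup>2 * \<bar>U r\<bar> powr p) \<le> V t - V s + \<mu> * integral {s..t} (\<lambda>r. V r / r))"

text \<open>The comparison function is \<open>w t = K (T0 - ln t) powr (-a)\<close>. The choice \<open>a = 2 / (p - 1)\<close> balances
  \<open>w powr p\<close> with the second derivative in \<open>ln t\<close>, and \<open>K powr (p - 1)\<close> proportional to \<open>T0\<close> lets the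
  nonlinearity absorb the damping as well. Then \<open>w 1\<close> is of order \<open>T0 powr (-1 / (p - 1))\<close>, which fits
  below data of size \<open>\<epsilon>\<close> when \<open>T0\<close> is a large multiple of \<open>\<epsilon> powr (-(p - 1))\<close>.\<close>

lemma damped_blow_up:
  fixes \<mu> c p I0 I1 :: real
  assumes "1 < \<mu>" "0 < c" "1 < p" "0 < I0" "0 < I1"
  obtains C where "0 < C"
    "\<And>\<epsilon> U V. 0 < \<epsilon> \<Longrightarrow> \<epsilon> \<le> 1 \<Longrightarrow> \<epsilon> * I0 \<le> U 1 \<Longrightarrow> \<epsilon> * I1 \<le> V 1 \<Longrightarrow>
      \<not> damped_supersolution \<mu> c p (exp (C * \<epsilon> powr (- (p - 1)))) U V"
proof -
  define a where "a = 2 / (p - 1)"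
  \<comment> \<open>\<open>c * B\<close> is the sum of the coefficients that the second derivative
    and the damping contribute in logarithmic time. \<open>Y\<close> is the value that
    \<open>C powr (a / 2)\<close> must exceed for \<open>w\<close> to start below the data; since
    \<open>a / 2 = 1 / (p - 1)\<close>, taking \<open>C\<close> just above
    \<open>Y powr (p - 1)\<close> suffices.\<close>
  define B where "B = (a * (a + 1) + (\<mu> - 1) * a) / c"
  define Y where "Y = B powr (a / 2) * (1 + a) / min I0 I1"
  define C where "C = 1 + Y powr (p - 1)"
  have a: "0 < a" and ap: "a * p = a + 2" and a2: "a / 2 = 1 / (p - 1)"
    using assms by (auto simp: a_def field_simps)
  have B: "0 < B" unfolding B_def using assms a by (intro divide_pos_pos add_pos_pos mult_pos_pos) auto
  have Y: "0 < Y" unfolding Y_def using assms a B by (intro divide_pos_pos mult_pos_pos) auto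
  have C: "1 \<le> C" by (simp add: C_def)
  have YC: "Y < C powr (a / 2)"
  proof -
    have "(Y powr (p - 1)) powr (a / 2) < C powr (a / 2)"
      using a by (intro powr_less_mono2) (auto simp: C_def)
    then show ?thesis using Y assms by (simp add: powr_powr a2)
  qed
  show ?thesis
  proof (rule that[of C])
    show "0 < C" using C by simp
    fix \<epsilon> :: real and U V :: "real \<Rightarrow> real"
    assume \<epsilon>: "0 < \<epsilon>" "\<epsilon> \<le> 1" and init: "\<epsilon> * I0 \<le> U 1" "\<epsilon> * I1 \<le> V 1"
    define T where "T = exp (C * \<epsilon> powr (- (p - 1)))"
    show "\<not> damped_supersolution \<mu> c p (exp (C * \<epsilon> powr (- (p - 1)))) U V"
      unfolding T_def[symmetric]
    proof
      assume "damped_supersolution \<mu> c p T U V"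
      then have U: "\<And>t. t \<in> {1..T} \<Longrightarrow> (U has_real_derivative V t) (at t within {1..T})"
        and V: "continuous_on {1..T} V"
        and super: "\<And>s t. 1 < s \<Longrightarrow> s < t \<Longrightarrow> t < T \<Longrightarrow>
          integral {s..t} (\<lambda>r. c / r\<^sup>2 * \<bar>U r\<bar> powr p) \<le> V t - V s + \<mu> * integral {s..t} (\<lambda>r. V r / r)"
        by (auto simp: damped_supersolution_def)
      define T0 where "T0 = C * \<epsilon> powr (- (p - 1))"
      \<comment> \<open>This is where \<open>\<epsilon> \<le> 1\<close> is used: it gives
        \<open>T0 \<ge> 1\<close>, needed below to absorb the term without damping and to bound
        \<open>w' 1\<close>.\<close>
      have "1 powr (p - 1) \<le> (1 / \<epsilon>) powr (p - 1)" using \<epsilon> assms by (intro powr_mono2) auto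
      then have "1 \<le> \<epsilon> powr (- (p - 1))"
        using \<epsilon> powr_minus_divide[of \<epsilon> "p - 1"] by (simp add: powr_divide)
      then have "1 * 1 \<le> T0" unfolding T0_def using C by (intro mult_mono) auto
      then have T0: "1 \<le> T0" by simp
      have TT0: "T = exp T0" by (simp add: T_def T0_def)
      then have "1 < T" using T0 by simp
      have T0_powr: "T0 powr (- a / 2) = C powr (- a / 2) * \<epsilon>"
      proof -
        have "(p - 1) * a = 2" using assms by (simp add: a_def field_simps)
        moreover have "- (p - 1) * (- a / 2) = (p - 1) * a / 2" by (simp add: field_simps)
        ultimately have "- (p - 1) * (- a / 2) = 1" by simp
        then have "(\<epsilon> powr (- (p - 1))) powr (- a / 2) = \<epsilon>"
          using \<epsilon> by (subst powr_powr) simp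
        then show ?thesis using C by (simp add: T0_def powr_mult)
      qed
      define K where "K = (B * T0) powr (a / 2)"
      have K: "0 < K" using B T0 by (simp add: K_def)
      have "K powr (p - 1) = B * T0" using B T0 assms by (simp add: K_def powr_powr a2)
      then have Kp: "K powr p = K * (B * T0)"
        using K powr_add[of K 1 "p - 1"] by simp
      \<comment> \<open>The factor \<open>1 + a\<close> serves both initial conditions at once:
        \<open>w 1\<close> is \<open>K * T0 powr (- a)\<close>, and \<open>w' 1\<close> is at most
        \<open>a\<close> times that.\<close>
      have small: "K * T0 powr (- a) * (1 + a) < \<epsilon> * min I0 I1"
      proof -
        have "K * T0 powr (- a) = B powr (a / 2) * (T0 powr (a / 2) * T0 powr (- a))"
          using B T0 by (simp add: K_def powr_mult)
        also have "T0 powr (a / 2) * T0 powr (- a) = T0 powr (- a / 2)"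
          by (simp add: powr_add[symmetric])
        finally have "K * T0 powr (- a) = B powr (a / 2) * (C powr (- a / 2) * \<epsilon>)"
          unfolding T0_powr .
        then have "K * T0 powr (- a) * (1 + a) = Y * min I0 I1 * C powr (- a / 2) * \<epsilon>"
          using assms by (simp add: Y_def)
        also have "Y * C powr (- a / 2) < 1"
          using YC C by (simp add: powr_minus_divide divide_less_eq)
        then have "Y * C powr (- a / 2) * (\<epsilon> * min I0 I1) < 1 * (\<epsilon> * min I0 I1)"
          using \<epsilon> assms by (intro mult_strict_right_mono) auto
        then have "Y * min I0 I1 * C powr (- a / 2) * \<epsilon> < \<epsilon> * min I0 I1" by (simp add: mult_ac)
        finally show ?thesis .
      qed
      define w where "w t = K * (T0 - ln t) powr (- a)" for t
      define w' where "w' t = a * K * (T0 - ln t) powr (- a - 1) / t" for t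
      define w'' where "w'' t = (a * (a + 1) * K * (T0 - ln t) powr (- a - 2)
        - a * K * (T0 - ln t) powr (- a - 1)) / t\<^sup>2" for t
      have ln_bounds: "0 < t" "0 < T0 - ln t" "T0 - ln t \<le> T0" if "t \<in> {1..<T}" for t
      proof -
        show "0 < t" using that by simp
        have "ln t < ln (exp T0)" using that TT0 by (subst ln_less_cancel_iff) auto
        then show "0 < T0 - ln t" by simp
        show "T0 - ln t \<le> T0" using that by simp
      qed
      have comp: "w t < U t" if "t \<in> {1..<T}" for t
      proof (rule damped_comparison[where T = T and U = U and w = w and \<mu> = \<mu> and c = c and p = p and w' = w' and w'' = w'' and V = V])
        show "(U has_real_derivative V t) (at t within {1..<T})" if "t \<in> {1..<T}" for t
          using that by (intro has_field_derivative_subset[OF U]) auto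
        show "continuous_on {1..<T} V" using V by (rule continuous_on_subset) auto
        have D: "((\<lambda>t. (T0 - ln t) powr e) has_real_derivative
          e * (T0 - ln t) powr (e - 1) * (- 1 / t)) (at t within {1..<T})" if "t \<in> {1..<T}" for t e
        proof -
          have "((\<lambda>t. T0 - ln t) has_real_derivative - 1 / t) (at t)"
            using ln_bounds[OF that] by (auto intro!: derivative_eq_intros)
          from DERIV_fun_powr[OF this, of e] show ?thesis
            using ln_bounds[OF that] by (auto intro: has_field_derivative_at_within)
        qed
        show "(w has_real_derivative w' t) (at t within {1..<T})" if "t \<in> {1..<T}" for t
          unfolding w_def w'_def using DERIV_cmult[OF D[OF that, of "- a"], of K] by (simp add: mult_ac)
        show "(w' has_real_derivative w'' t) (at t within {1..<T})" if "t \<in> {1..<T}" for t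
        proof -
          define P where "P = (T0 - ln t) powr (- a - 2)"
          have P: "(T0 - ln t) powr (- a - 1 - 1) = P" by (simp add: P_def algebra_simps)
          have "((\<lambda>t. a * K * (T0 - ln t) powr (- a - 1) / t) has_real_derivative
            (a * K * ((- a - 1) * P * (- 1 / t)) * t - a * K * (T0 - ln t) powr (- a - 1) * 1) / (t * t))
            (at t within {1..<T})"
            using DERIV_divide[OF DERIV_cmult[OF D[OF that, of "- a - 1"], of "a * K"] DERIV_ident]
              ln_bounds[OF that] unfolding P by simp
          moreover have "(a * K * ((- a - 1) * P * (- 1 / t)) * t - a * K * (T0 - ln t) powr (- a - 1) * 1) / (t * t) = w'' t"
            unfolding w''_def P_def[symmetric] using ln_bounds[OF that]
            by (simp add: power2_eq_square algebra_simps)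
          ultimately show ?thesis unfolding w'_def by simp
        qed
        show "w'' t + \<mu> * w' t / t \<le> c / t\<^sup>2 * w t powr p" if "t \<in> {1..<T}" for t
        proof -
          define x where "x = T0 - ln t"
          have x: "0 < t" "0 < x" "x \<le> T0" using ln_bounds[OF that] by (auto simp: x_def)
          have "x powr (- a - 1) = x powr (1 + (- a - 2))"
            by (rule arg_cong[where f = "(powr) x"]) simp
          also have "\<dots> = x * x powr (- a - 2)" using x by (subst powr_add) simp
          finally have e1: "x powr (- a - 1) = x * x powr (- a - 2)" .
          have e2: "w t powr p = K * (B * T0) * x powr (- a - 2)"
            using K x ap by (simp add: w_def x_def[symmetric] powr_mult powr_powr Kp)
          \<comment> \<open>Differentiating the factor \<open>1 / t\<close> in \<open>w'\<close>
            lowers the damping coefficient from \<mu> to \<open>\<mu> - 1\<close>. As this is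
            positive, \<open>x \<le> T0\<close> and \<open>1 \<le> T0\<close> bound both
            contributions by a multiple of \<open>T0\<close>.\<close>
          have "w'' t + \<mu> * w' t / t = (a * (a + 1) + (\<mu> - 1) * a * x) * (K * x powr (- a - 2) / t\<^sup>2)"
            unfolding w''_def w'_def x_def[symmetric] e1 using x
            by (simp add: field_simps power2_eq_square)
          also have "\<dots> \<le> (c * B * T0) * (K * x powr (- a - 2) / t\<^sup>2)"
          proof (rule mult_right_mono)
            have "a * (a + 1) * 1 \<le> a * (a + 1) * T0" using a T0 by (intro mult_left_mono) auto
            moreover have "(\<mu> - 1) * a * x \<le> (\<mu> - 1) * a * T0"
              using a assms x by (intro mult_left_mono) auto
            moreover have "c * B = a * (a + 1) + (\<mu> - 1) * a" using assms by (simp add: B_def)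
            ultimately show "a * (a + 1) + (\<mu> - 1) * a * x \<le> c * B * T0"
              by (simp add: distrib_right)
          qed (use K in auto)
          also have "\<dots> = c / t\<^sup>2 * w t powr p" by (simp add: e2)
          finally show ?thesis .
        qed
        have min: "\<epsilon> * min I0 I1 \<le> \<epsilon> * I0" "\<epsilon> * min I0 I1 \<le> \<epsilon> * I1" using \<epsilon> by (auto intro: mult_left_mono)
        have pos: "0 \<le> K * T0 powr (- a)" "0 \<le> K * T0 powr (- a) * a" using K a by auto
        have w1: "w 1 = K * T0 powr (- a)" by (simp add: w_def)
        show "w 1 < U 1" unfolding w1 using small pos min init by (simp add: distrib_left)
        have "w' 1 = K * T0 powr (- a) * a / T0" using T0 by (simp add: w'_def powr_diff)
        also have "\<dots> \<le> K * T0 powr (- a) * a / 1" using T0 pos by (intro divide_left_mono) auto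
        finally show "w' 1 < V 1" using small pos min init by (simp add: distrib_left)
      qed (use that assms super K in \<open>auto simp: w_def\<close>)
      have "continuous_on {1..T} U" by (rule DERIV_continuous_on[OF U])
      then obtain M where "\<forall>t\<in>{1..T}. U t \<le> M"
        using continuous_attains_sup[of "{1..T}" U] \<open>1 < T\<close> by fastforce
      then have M: "U t \<le> M" if "t \<in> {1..T}" for t using that by blast
      \<comment> \<open>Raising the bound of \<open>U\<close> to at least \<open>w 1\<close> ensures
        that \<open>w\<close> takes the value \<open>M'\<close> at a time not before
        \<open>1\<close>; below, \<open>x\<close> is the remaining logarithmic time
        \<open>T0 - ln t\<close> at that moment.\<close>
      define M' where "M' = max M (K * T0 powr (- a))"
      have M': "0 < M'" "M \<le> M'" "K * T0 powr (- a) \<le> M'"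
        using K T0 by (auto simp: M'_def less_max_iff_disj)
      define x where "x = (M' / K) powr (- 1 / a)"
      have x: "0 < x" "K * x powr (- a) = M'" using K M' a by (auto simp: x_def powr_powr)
      have "x \<le> T0"
      proof (rule ccontr)
        assume "\<not> x \<le> T0"
        then have "x powr (- a) < T0 powr (- a)" using a T0 by (intro powr_less_mono2_neg) auto
        then have "K * x powr (- a) < K * T0 powr (- a)" using K by simp
        with x M' show False by simp
      qed
      define t where "t = exp (T0 - x)"
      have t: "t \<in> {1..<T}" using \<open>x \<le> T0\<close> x(1) by (auto simp: t_def TT0)
      have "w t = M'" using x by (simp add: w_def t_def)
      with comp[OF t] M[of t] t M' show False by auto
    qed
  qed
qed

section \<open>Square integrable functions, weak gradients and slices\<close>

lemma L2_measurable: "f \<in> L2 \<Longrightarrow> f \<in> borel_measurable lebesgue"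
  and L2_integrable: "f \<in> L2 \<Longrightarrow> integrable lebesgue (\<lambda>x. (norm (f x))\<^sup>2)"
  by (auto simp: L2_def)

lemma norm_scaleR_le_sum_squares:
  fixes c :: real and v :: "'b::real_normed_vector"
  shows "norm (c *\<^sub>R v) \<le> (norm c)\<^sup>2 + (norm v)\<^sup>2"
proof -
  have "0 \<le> (\<bar>c\<bar> - norm v)\<^sup>2" "0 \<le> \<bar>c\<bar> * norm v" by simp_all
  then have "\<bar>c\<bar> * norm v \<le> \<bar>c\<bar>\<^sup>2 + (norm v)\<^sup>2"
    unfolding power2_diff by linarith
  then show ?thesis by simp
qed

lemma integrable_L2_scaleR:
  fixes \<phi> :: "'a::euclidean_space \<Rightarrow> real" and g :: "'a \<Rightarrow> 'b::euclidean_space"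
  assumes "\<phi> \<in> L2" "g \<in> L2"
  shows "integrable lebesgue (\<lambda>x. \<phi> x *\<^sub>R g x)"
proof (rule Bochner_Integration.integrable_bound)
  show "integrable lebesgue (\<lambda>x. (norm (\<phi> x))\<^sup>2 + (norm (g x))\<^sup>2)"
    by (intro Bochner_Integration.integrable_add L2_integrable assms)
  show "(\<lambda>x. \<phi> x *\<^sub>R g x) \<in> borel_measurable lebesgue"
    by (intro borel_measurable_scaleR L2_measurable assms)
  show "AE x in lebesgue. norm (\<phi> x *\<^sub>R g x) \<le> norm ((norm (\<phi> x))\<^sup>2 + (norm (g x))\<^sup>2)"
    by (intro AE_I2 order_trans[OF norm_scaleR_le_sum_squares]) auto
qed

lemma integrable_L2_mult:
  fixes f g :: "'a::euclidean_space \<Rightarrow> real"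
  assumes "f \<in> L2" "g \<in> L2"
  shows "integrable lebesgue (\<lambda>x. f x * g x)"
  using integrable_L2_scaleR[OF assms] by simp

lemma L2_diff:
  fixes f g :: "'a::euclidean_space \<Rightarrow> 'b::euclidean_space"
  assumes "f \<in> L2" "g \<in> L2"
  shows "(\<lambda>x. f x - g x) \<in> L2"
proof -
  have "integrable lebesgue (\<lambda>x. (norm (f x - g x))\<^sup>2)"
  proof (rule Bochner_Integration.integrable_bound)
    show "integrable lebesgue (\<lambda>x. 2 * (norm (f x))\<^sup>2 + 2 * (norm (g x))\<^sup>2)"
      by (intro Bochner_Integration.integrable_add integrable_mult_right L2_integrable assms)
    show "(\<lambda>x. (norm (f x - g x))\<^sup>2) \<in> borel_measurable lebesgue"
      using L2_measurable[OF assms(1)] L2_measurable[OF assms(2)] by measurable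
    have "(norm (f x - g x))\<^sup>2 \<le> 2 * (norm (f x))\<^sup>2 + 2 * (norm (g x))\<^sup>2" for x
    proof -
      have "(norm (f x - g x))\<^sup>2 \<le> (norm (f x) + norm (g x))\<^sup>2"
        by (intro power_mono norm_triangle_ineq4) auto
      also have "\<dots> \<le> 2 * (norm (f x))\<^sup>2 + 2 * (norm (g x))\<^sup>2"
        using sum_squares_bound[of "norm (f x)" "norm (g x)"] by (simp add: power2_sum)
      finally show ?thesis .
    qed
    then show "AE x in lebesgue. norm ((norm (f x - g x))\<^sup>2) \<le> norm (2 * (norm (f x))\<^sup>2 + 2 * (norm (g x))\<^sup>2)"
      by simp
  qed
  then show ?thesis
    using assms by (auto simp: L2_def intro: borel_measurable_diff)
qed

lemma L2_cmult:
  fixes f :: "'a::euclidean_space \<Rightarrow> real"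
  assumes "f \<in> L2" shows "(\<lambda>x. c * f x) \<in> L2"
  using assms by (auto simp: L2_def power_mult_distrib)

text \<open>Integrating the square of \<open>B * f - C * g\<close> yields
  \<open>B * (A * B - C\<^sup>2) \<ge> 0\<close>; when \<open>B = 0\<close>, \<open>g\<close>
  vanishes almost everywhere.\<close>

lemma Cauchy_Schwarz_L2:
  fixes f g :: "'a::euclidean_space \<Rightarrow> real"
  assumes "f \<in> L2" "g \<in> L2"
  shows "\<bar>LINT x|lebesgue. f x * g x\<bar> \<le> L2_norm f * L2_norm g"
proof -
  define A B C where "A = (LINT x|lebesgue. (norm (f x))\<^sup>2)"
    and "B = (LINT x|lebesgue. (norm (g x))\<^sup>2)" and "C = (LINT x|lebesgue. f x * g x)"
  have "0 \<le> A" "0 \<le> B" by (auto simp: A_def B_def)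
  have "C\<^sup>2 \<le> A * B"
  proof (cases "B = 0")
    case True
    then have "AE x in lebesgue. (norm (g x))\<^sup>2 = 0"
      using integral_nonneg_eq_0_iff_AE[OF L2_integrable[OF assms(2)]] by (simp add: B_def)
    then have "C = 0" unfolding C_def by (intro integral_eq_zero_AE) auto
    then show ?thesis by (simp add: True)
  next
    case False
    have "0 \<le> (LINT x|lebesgue. B\<^sup>2 * (norm (f x))\<^sup>2 - 2 * B * C * (f x * g x) + C\<^sup>2 * (norm (g x))\<^sup>2)"
    proof (rule Bochner_Integration.integral_nonneg)
      fix x
      have "B\<^sup>2 * (norm (f x))\<^sup>2 - 2 * B * C * (f x * g x) + C\<^sup>2 * (norm (g x))\<^sup>2 = (B * f x - C * g x)\<^sup>2"
        by (simp add: power2_eq_square algebra_simps)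
      then show "0 \<le> B\<^sup>2 * (norm (f x))\<^sup>2 - 2 * B * C * (f x * g x) + C\<^sup>2 * (norm (g x))\<^sup>2" by simp
    qed
    also have "\<dots> = B\<^sup>2 * A - 2 * B * C * C + C\<^sup>2 * B"
      using L2_integrable[OF assms(1)] L2_integrable[OF assms(2)] integrable_L2_mult[OF assms]
      by (simp add: A_def B_def C_def)
    also have "\<dots> = B * (A * B - C\<^sup>2)" by (simp add: power2_eq_square algebra_simps)
    finally show ?thesis using False \<open>0 \<le> B\<close> by (simp add: zero_le_mult_iff)
  qed
  then have "sqrt (C\<^sup>2) \<le> sqrt (A * B)" by (rule real_sqrt_le_mono)
  then show ?thesis by (simp add: real_sqrt_mult L2_norm_def A_def B_def C_def)
qed

lemma tendsto_L2_pairing: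
  fixes F :: "real \<Rightarrow> 'a::euclidean_space \<Rightarrow> real"
  assumes "\<And>s. s \<in> I \<Longrightarrow> F s \<in> L2" "g \<in> L2" "((\<lambda>s. L2_norm (F s)) \<longlongrightarrow> 0) (at t within I)"
  shows "((\<lambda>s. LINT x|lebesgue. F s x * g x) \<longlongrightarrow> 0) (at t within I)"
proof (rule Lim_null_comparison)
  show "\<forall>\<^sub>F s in at t within I. norm (LINT x|lebesgue. F s x * g x) \<le> L2_norm (F s) * L2_norm g"
    unfolding eventually_at_filter using Cauchy_Schwarz_L2[OF assms(1,2)] by (auto intro: always_eventually)
  show "((\<lambda>s. L2_norm (F s) * L2_norm g) \<longlongrightarrow> 0) (at t within I)"
    using tendsto_mult_right[OF assms(3), of "L2_norm g"] by simp
qed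

lemma continuous_on_L2_pairing:
  assumes "C_L2 I v" "g \<in> L2"
  shows "continuous_on I (\<lambda>t. LINT x|lebesgue. v t x * g x)"
  unfolding continuous_on
proof
  fix t assume t: "t \<in> I"
  have v: "v s \<in> L2" if "s \<in> I" for s using assms(1) that by (auto simp: C_L2_def)
  have "((\<lambda>s. LINT x|lebesgue. (v s x - v t x) * g x) \<longlongrightarrow> 0) (at t within I)"
    using assms t v by (intro tendsto_L2_pairing L2_diff) (auto simp: C_L2_def)
  then have "((\<lambda>s. (LINT x|lebesgue. v s x * g x) - (LINT x|lebesgue. v t x * g x)) \<longlongrightarrow> 0) (at t within I)"
  proof (rule Lim_transform_eventually)
    show "\<forall>\<^sub>F s in at t within I. (LINT x|lebesgue. (v s x - v t x) * g x)
        = (LINT x|lebesgue. v s x * g x) - (LINT x|lebesgue. v t x * g x)"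
      unfolding eventually_at_filter
      using v t assms(2) by (auto intro!: always_eventually simp: left_diff_distrib integrable_L2_mult)
  qed
  then show "((\<lambda>t. LINT x|lebesgue. v t x * g x) \<longlongrightarrow> (LINT x|lebesgue. v t x * g x)) (at t within I)"
    by (simp add: LIM_zero_iff)
qed

text \<open>Differentiability in the L2 norm passes to scalar functions only against a fixed L2
  function. The constant \<open>1\<close> is not one, so the mean is reached by pairing with a
  cutoff.\<close>

lemma C1_L2_pairing_derivative:
  assumes "C1_L2 I u v" "g \<in> L2" "t \<in> I"
  shows "((\<lambda>s. LINT x|lebesgue. u s x * g x) has_real_derivative (LINT x|lebesgue. v t x * g x)) (at t within I)"
proof -
  have u: "u s \<in> L2" "v s \<in> L2" if "s \<in> I" for s
    using assms(1) that by (auto simp: C1_L2_def C_L2_def)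
  have q: "(\<lambda>x. (u s x - u t x) / (s - t)) \<in> L2" if "s \<in> I" for s
    using L2_cmult[OF L2_diff[OF u(1)[OF that] u(1)[OF assms(3)]], of "1 / (s - t)"] by simp
  have "((\<lambda>s. LINT x|lebesgue. ((u s x - u t x) / (s - t) - v t x) * g x) \<longlongrightarrow> 0) (at t within I)"
    using assms u q by (intro tendsto_L2_pairing L2_diff) (auto simp: C1_L2_def)
  then have "((\<lambda>s. ((LINT x|lebesgue. u s x * g x) - (LINT x|lebesgue. u t x * g x)) / (s - t)
      - (LINT x|lebesgue. v t x * g x)) \<longlongrightarrow> 0) (at t within I)"
  proof (rule Lim_transform_eventually)
    show "\<forall>\<^sub>F s in at t within I. (LINT x|lebesgue. ((u s x - u t x) / (s - t) - v t x) * g x)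
        = ((LINT x|lebesgue. u s x * g x) - (LINT x|lebesgue. u t x * g x)) / (s - t)
          - (LINT x|lebesgue. v t x * g x)"
      unfolding eventually_at_filter
    proof (intro always_eventually allI impI)
      fix s assume "s \<noteq> t" "s \<in> I"
      have i: "integrable lebesgue (\<lambda>x. u s x * g x)" "integrable lebesgue (\<lambda>x. u t x * g x)"
        "integrable lebesgue (\<lambda>x. v t x * g x)"
        using u \<open>s \<in> I\<close> assms by (auto intro: integrable_L2_mult)
      have "(LINT x|lebesgue. ((u s x - u t x) / (s - t) - v t x) * g x)
          = (LINT x|lebesgue. (u s x * g x - u t x * g x) / (s - t) - v t x * g x)"
        by (intro Bochner_Integration.integral_cong) (auto simp: left_diff_distrib)
      also have "\<dots> = ((LINT x|lebesgue. u s x * g x) - (LINT x|lebesgue. u t x * g x)) / (s - t)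
          - (LINT x|lebesgue. v t x * g x)"
        using i by simp
      finally show "(LINT x|lebesgue. ((u s x - u t x) / (s - t) - v t x) * g x)
        = ((LINT x|lebesgue. u s x * g x) - (LINT x|lebesgue. u t x * g x)) / (s - t)
          - (LINT x|lebesgue. v t x * g x)" .
    qed
  qed
  then show ?thesis by (simp add: has_field_derivative_iff LIM_zero_iff)
qed

lemma continuous_compact_support_L2:
  fixes f :: "'a::euclidean_space \<Rightarrow> real"
  assumes "continuous_on UNIV f" "compact (closure {x. f x \<noteq> 0})"
  shows "f \<in> L2"
proof -
  define K where "K = closure {x. f x \<noteq> 0}"
  have f0: "f x = 0" if "x \<notin> K" for x
    using that closure_subset[of "{x. f x \<noteq> 0}"] by (auto simp: K_def)
  have "integrable lborel (\<lambda>x. indicator K x *\<^sub>R (f x)\<^sup>2)"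
    using assms unfolding K_def
    by (intro borel_integrable_compact continuous_intros) (auto intro: continuous_on_subset)
  also have "(\<lambda>x. indicator K x *\<^sub>R (f x)\<^sup>2) = (\<lambda>x. (norm (f x))\<^sup>2)"
    using f0 by (intro ext) (auto simp: indicator_def)
  finally have "integrable lborel (\<lambda>x. (norm (f x))\<^sup>2)" .
  then have "integrable lebesgue (\<lambda>x. (norm (f x))\<^sup>2)"
    by (subst integrable_completion) (auto dest: borel_measurable_integrable)
  moreover have "f \<in> borel_measurable lebesgue"
    using assms(1) by (intro measurable_completion) (simp add: borel_measurable_continuous_onI)
  ultimately show ?thesis by (simp add: L2_def)
qed

lemma test_fun_L2: "test_fun UNIV \<phi> \<Longrightarrow> \<phi> \<in> L2"
  by (rule continuous_compact_support_L2) (auto simp: test_fun_def smooth_continuous_on)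

section \<open>Test functions, weak gradients and essential supports\<close>

lemma frechet_derivative_zero_open:
  assumes "open S" "x \<in> S" "\<And>y. y \<in> S \<Longrightarrow> f y = c"
  shows "frechet_derivative f (at x) = (\<lambda>_. 0)"
proof -
  have "(f has_derivative (\<lambda>_. 0)) (at x)"
    by (rule has_derivative_transform_within_open[OF has_derivative_const[of c] assms(1,2)])
      (simp add: assms(3))
  then show ?thesis by (simp add: frechet_derivative_at[symmetric])
qed

lemma test_fun_directional_derivative:
  assumes "test_fun UNIV \<phi>"
  shows "test_fun UNIV (\<lambda>x. frechet_derivative \<phi> (at x) v)"
proof -
  define K where "K = closure {x. \<phi> x \<noteq> 0}"
  have "compact K" using assms by (simp add: K_def test_fun_def)
  have "frechet_derivative \<phi> (at x) v = 0" if "x \<notin> K" for x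
    using closure_subset[of "{x. \<phi> x \<noteq> 0}"] that
    by (subst frechet_derivative_zero_open[of "- K" x \<phi> 0]) (auto simp: K_def)
  then have "{x. frechet_derivative \<phi> (at x) v \<noteq> 0} \<subseteq> K" by auto
  then have "closure {x. frechet_derivative \<phi> (at x) v \<noteq> 0} \<subseteq> K"
    using \<open>compact K\<close> by (simp add: closure_minimal compact_imp_closed)
  then have "compact (closure {x. frechet_derivative \<phi> (at x) v \<noteq> 0})"
    using \<open>compact K\<close> by (metis closed_closure compact_Int_closed inf.absorb_iff2)
  then show ?thesis
    using assms by (simp add: test_fun_def smooth_frechet_derivative)
qed

text \<open>Integrating by parts once more moves the gradient onto \<^term>\<open>grad \<phi>\<close>, whose own derivatives
  vanish where \<open>f\<close> lives; so nothing need be known about the support of the weak gradient.\<close>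

lemma integral_weak_grad_cutoff_zero:
  fixes f :: "'a::euclidean_space \<Rightarrow> real"
  assumes f: "f \<in> H1" and \<phi>: "test_fun UNIV \<phi>" and S: "open S" "\<And>x. x \<in> S \<Longrightarrow> \<phi> x = 1"
    and supp: "AE x in lebesgue. x \<notin> S \<longrightarrow> f x = 0"
  shows "(LINT x|lebesgue. weak_grad f x \<bullet> grad \<phi> x) = 0"
proof -
  define g where "g = weak_grad f"
  have "\<exists>g. g \<in> L2 \<and> has_weak_grad f g" using f by (auto simp: H1_def)
  then have g: "g \<in> L2" "has_weak_grad f g"
    unfolding g_def weak_grad_def by (metis (mono_tags, lifting) someI_ex)+
  define d where "d b x = frechet_derivative \<phi> (at x) b" for b x
  have d: "test_fun UNIV (d b)" for b
    unfolding d_def by (rule test_fun_directional_derivative[OF \<phi>])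
  have "d b x = 0" if "x \<in> S" for b x
    unfolding d_def by (subst frechet_derivative_zero_open[OF S(1) that S(2)]) auto
  then have "frechet_derivative (d b) (at x) = (\<lambda>_. 0)" if "x \<in> S" for b x
    using frechet_derivative_zero_open[OF S(1) that, of "d b" 0] by simp
  then have "grad (d b) x = 0" if "x \<in> S" for b x
    using that by (simp add: grad_def)
  then have fd: "(LINT x|lebesgue. f x *\<^sub>R grad (d b) x) = 0" for b
    using supp by (intro integral_eq_zero_AE) auto
  have i: "integrable lebesgue (\<lambda>x. d b x *\<^sub>R g x)" for b
    by (intro integrable_L2_scaleR test_fun_L2 d g)
  have dg: "(LINT x|lebesgue. d b x *\<^sub>R g x) = 0" for b
    using g(2) d[of b] fd[of b] by (simp add: has_weak_grad_def)
  have "(LINT x|lebesgue. g x \<bullet> grad \<phi> x) = (LINT x|lebesgue. (\<Sum>b\<in>Basis. (d b x *\<^sub>R g x) \<bullet> b))"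
    by (intro Bochner_Integration.integral_cong) (auto simp: grad_def d_def inner_sum_right)
  also have "\<dots> = (\<Sum>b\<in>Basis. (LINT x|lebesgue. (d b x *\<^sub>R g x) \<bullet> b))"
    using i by (intro Bochner_Integration.integral_sum integrable_inner_left) auto
  also have "\<dots> = (\<Sum>b\<in>Basis. (LINT x|lebesgue. d b x *\<^sub>R g x) \<bullet> b)"
    by (intro sum.cong refl integral_inner_left i)
  finally show ?thesis unfolding dg by (simp add: g_def)
qed

text \<open>The complement of the essential support is a union of possibly uncountably many open
  sets on which \<open>f\<close> vanishes almost everywhere; the Lindelof property leaves only
  countably many null sets to unite.\<close>

lemma AE_zero_outside_ess_supp:
  fixes f :: "'a::euclidean_space \<Rightarrow> real"
  assumes "ess_supp f \<subseteq> S"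
  shows "AE x in lebesgue. x \<notin> S \<longrightarrow> f x = 0"
proof -
  define F where "F = {U. open U \<and> (AE x in lebesgue. x \<in> U \<longrightarrow> f x = 0)}"
  obtain F' where F': "F' \<subseteq> F" "countable F'" "\<Union>F' = \<Union>F"
    by (rule Lindelof[of F]) (auto simp: F_def)
  have "\<forall>U\<in>F'. AE x in lebesgue. x \<in> U \<longrightarrow> f x = 0" using F'(1) by (auto simp: F_def)
  then have "AE x in lebesgue. \<forall>U\<in>F'. x \<in> U \<longrightarrow> f x = 0"
    by (simp only: AE_ball_countable[OF F'(2)])
  then show ?thesis
  proof eventually_elim
    case (elim x)
    show ?case
    proof
      assume "x \<notin> S"
      then have "x \<in> \<Union>F'" using assms F'(3) by (auto simp: ess_supp_def F_def)
      then show "f x = 0" using elim by auto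
    qed
  qed
qed

section \<open>Completeness of Lebesgue measure and slices\<close>

lemma borel_measurable_lebesgue_AE:
  fixes f g :: "'a::euclidean_space \<Rightarrow> 'b::topological_space"
  assumes "f \<in> borel_measurable lebesgue" "AE x in lebesgue. f x = g x"
  shows "g \<in> borel_measurable lebesgue"
proof (rule measurableI)
  fix A :: "'b set" assume "A \<in> sets borel"
  then have "f -` A \<inter> space lebesgue \<in> sets lebesgue" by (rule measurable_sets[OF assms(1)])
  moreover have "AE x in lebesgue. x \<in> f -` A \<inter> space lebesgue \<longleftrightarrow> x \<in> g -` A \<inter> space lebesgue"
    using assms(2) by eventually_elim auto
  ultimately show "g -` A \<inter> space lebesgue \<in> sets lebesgue"
    using completion.in_sets_AE by blast
qed auto

lemma integrable_lebesgue_AE_cong: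
  fixes f g :: "'a::euclidean_space \<Rightarrow> real"
  assumes "integrable lebesgue f" "AE x in lebesgue. f x = g x"
  shows "integrable lebesgue g"
  using assms borel_measurable_lebesgue_AE[OF _ assms(2)] integrable_cong_AE[of f lebesgue g]
  by (auto dest: borel_measurable_integrable)

text \<open>A Lebesgue measurable function need not have measurable slices everywhere. Fubini's
  theorem is applied to a Borel function \<open>G\<close> equal to \<open>F\<close> almost
  everywhere, and almost every slice of \<open>F\<close> agrees almost everywhere with that of
  \<open>G\<close>.\<close>

lemma lebesgue_Fubini:
  fixes F :: "'a::euclidean_space \<times> 'b::euclidean_space \<Rightarrow> real"
  assumes "integrable lebesgue F"
  shows "AE s in lebesgue. integrable lebesgue (\<lambda>x. F (s, x))"
    and "integrable lebesgue (\<lambda>s. LINT x|lebesgue. F (s, x))"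
proof -
  obtain G where G: "G \<in> borel_measurable lborel" "AE z in lborel. F z = G z"
    using completion_ex_borel_measurable_real[OF borel_measurable_integrable[OF assms]] by auto
  then have "integrable lebesgue G"
    using assms by (blast intro: integrable_lebesgue_AE_cong AE_completion)
  then have Gi: "integrable (lborel \<Otimes>\<^sub>M lborel) G"
    using G(1) by (simp add: integrable_completion lborel_prod)
  have slice: "AE s in lborel. AE x in lborel. F (s, x) = G (s, x)"
    using lborel_pair.AE_pair[of "\<lambda>z. F z = G z"] G(2) unfolding lborel_prod by simp
  have Gs: "(\<lambda>x. G (s, x)) \<in> borel_measurable lborel" for s
    using borel_measurable_integrable[OF Gi] by simp
  show "AE s in lebesgue. integrable lebesgue (\<lambda>x. F (s, x))"
  proof (rule AE_completion)
    show "AE s in lborel. integrable lebesgue (\<lambda>x. F (s, x))"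
      using slice lborel_pair.AE_integrable_fst'[OF Gi]
    proof eventually_elim
      case (elim s)
      then have "integrable lebesgue (\<lambda>x. G (s, x))" by (simp add: integrable_completion Gs)
      then show ?case
        using AE_completion[OF elim(1)] by (auto elim!: integrable_lebesgue_AE_cong simp: eq_commute)
    qed
  qed
  have "integrable lborel (\<lambda>s. LINT x|lborel. G (s, x))"
    by (rule lborel_pair.integrable_fst'[OF Gi])
  then have "integrable lebesgue (\<lambda>s. LINT x|lborel. G (s, x))"
    by (simp add: integrable_completion borel_measurable_integrable)
  moreover have "AE s in lebesgue. (LINT x|lborel. G (s, x)) = (LINT x|lebesgue. F (s, x))"
  proof (rule AE_completion)
    show "AE s in lborel. (LINT x|lborel. G (s, x)) = (LINT x|lebesgue. F (s, x))"
      using slice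
    proof eventually_elim
      case (elim s)
      have "(\<lambda>x. G (s, x)) \<in> borel_measurable lebesgue" using Gs by (rule measurable_completion)
      moreover have ae: "AE x in lebesgue. G (s, x) = F (s, x)"
        using AE_completion[OF elim] by (simp add: eq_commute)
      ultimately have "(LINT x|lebesgue. G (s, x)) = (LINT x|lebesgue. F (s, x))"
        by (intro integral_cong_AE borel_measurable_lebesgue_AE[OF _ ae])
      then show ?case using integral_completion[OF Gs, of s] by simp
    qed
  qed
  ultimately show "integrable lebesgue (\<lambda>s. LINT x|lebesgue. F (s, x))"
    by (rule integrable_lebesgue_AE_cong)
qed

text \<open>Young's inequality for \<open>x\<close> and \<open>m powr (p - 1)\<close> with exponents
  \<open>p\<close> and \<open>p / (p - 1)\<close> is exactly this convexity bound after
  rearranging.\<close>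

lemma powr_tangent_line:
  fixes x m p :: real
  assumes "1 < p" "0 \<le> x" "0 \<le> m"
  shows "m powr p + p * m powr (p - 1) * (x - m) \<le> x powr p"
proof (cases "m = 0")
  case True
  then show ?thesis using assms by simp
next
  case False
  have "x * m powr (p - 1) \<le> x powr p / p + (m powr (p - 1)) powr (p / (p - 1)) / (p / (p - 1))"
    using assms by (intro Youngs_inequality) (auto simp: field_simps)
  also have "(m powr (p - 1)) powr (p / (p - 1)) = m powr p" using assms by (simp add: powr_powr)
  finally have "p * (x * m powr (p - 1)) \<le> p * (x powr p / p + m powr p / (p / (p - 1)))"
    using assms by (intro mult_left_mono) auto
  also have "\<dots> = x powr p + (p - 1) * m powr p" using assms by (simp add: field_simps)
  also have "m powr p = m powr (p - 1) * m" using powr_add[of m "p - 1" 1] assms False by simp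
  finally show ?thesis
    using powr_add[of m "p - 1" 1] assms False by (simp add: algebra_simps)
qed

text \<open>Jensen's inequality, by integrating the tangent line at the mean of \<open>f\<close> over its support.\<close>

lemma powr_integral_le_on_support:
  fixes f :: "'a::euclidean_space \<Rightarrow> real"
  assumes "1 < p" and B: "B \<in> lmeasurable" "0 < measure lebesgue B"
    and f: "integrable lebesgue f" "integrable lebesgue (\<lambda>x. \<bar>f x\<bar> powr p)"
    and supp: "AE x in lebesgue. x \<notin> B \<longrightarrow> f x = 0"
  shows "measure lebesgue B powr (1 - p) * \<bar>LINT x|lebesgue. f x\<bar> powr p
    \<le> (LINT x|lebesgue. \<bar>f x\<bar> powr p)"
proof -
  define M where "M = measure lebesgue B"
  define m where "m = \<bar>LINT x|lebesgue. f x\<bar> / M"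
  have M: "0 < M" using B by (simp add: M_def)
  have m: "0 \<le> m" using M by (simp add: m_def)
  have iB: "integrable lebesgue (indicator B :: 'a \<Rightarrow> real)"
    using B by (intro integrable_real_indicator) (auto simp: fmeasurable_def)
  \<comment> \<open>The tangent line at \<open>m\<close> integrates over \<open>B\<close> to
    \<open>m powr p * M\<close> if the integral of \<open>\<bar>f\<bar>\<close> is replaced by the
    smaller \<open>\<bar>LINT x|lebesgue. f x\<bar>\<close>, which is harmless as the slope is
    nonnegative. Its constant part carries the indicator of \<open>B\<close>, so off
    \<open>B\<close> both sides vanish.\<close>
  have "m powr p * M = (m powr p - p * m powr (p - 1) * m) * M + p * m powr (p - 1) * \<bar>LINT x|lebesgue. f x\<bar>"
    using M by (simp add: m_def field_simps)
  also have "\<dots> \<le> (m powr p - p * m powr (p - 1) * m) * M + p * m powr (p - 1) * (LINT x|lebesgue. \<bar>f x\<bar>)"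
    using assms(1) by (intro add_left_mono mult_left_mono integral_abs_bound) auto
  also have "\<dots> = (LINT x|lebesgue. (m powr p - p * m powr (p - 1) * m) * indicator B x + p * m powr (p - 1) * \<bar>f x\<bar>)"
    using iB f by (simp add: M_def)
  also have "\<dots> \<le> (LINT x|lebesgue. \<bar>f x\<bar> powr p)"
  proof (rule integral_mono_AE)
    show "integrable lebesgue (\<lambda>x. (m powr p - p * m powr (p - 1) * m) * indicator B x + p * m powr (p - 1) * \<bar>f x\<bar>)"
      using iB f by (intro Bochner_Integration.integrable_add integrable_mult_right integrable_abs)
    show "AE x in lebesgue. (m powr p - p * m powr (p - 1) * m) * indicator B x + p * m powr (p - 1) * \<bar>f x\<bar>
      \<le> \<bar>f x\<bar> powr p"
      using supp
    proof eventually_elim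
      case (elim x)
      show ?case
      proof (cases "x \<in> B")
        case True
        then show ?thesis using powr_tangent_line[OF assms(1) _ m, of "\<bar>f x\<bar>"] by (simp add: algebra_simps)
      qed (use elim in auto)
    qed
  qed fact
  finally have "m powr p * M \<le> (LINT x|lebesgue. \<bar>f x\<bar> powr p)" .
  moreover have "m powr p * M = M powr (1 - p) * \<bar>LINT x|lebesgue. f x\<bar> powr p"
    using M by (simp add: m_def powr_divide powr_diff)
  ultimately show ?thesis by (simp add: M_def)
qed

section \<open>The spatial mean of an energy solution\<close>

lemma integrable_L2_bounded_support:
  fixes f :: "'a::euclidean_space \<Rightarrow> real"
  assumes "f \<in> L2" "AE x in lebesgue. x \<notin> ball 0 r \<longrightarrow> f x = 0"
  shows "integrable lebesgue f"
proof -
  have "integrable lebesgue (indicator (ball 0 r) :: 'a \<Rightarrow> real)"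
    using lmeasurable_ball[of 0 r] by (intro integrable_real_indicator) (auto simp: fmeasurable_def)
  moreover have "(\<lambda>x. (norm (indicator (ball 0 r) x :: real))\<^sup>2) = (indicator (ball 0 r) :: 'a \<Rightarrow> real)"
    by (auto simp: indicator_def)
  ultimately have "(indicator (ball 0 r) :: 'a \<Rightarrow> real) \<in> L2"
    by (auto simp: L2_def dest: borel_measurable_integrable)
  from integrable_L2_mult[OF assms(1) this] show ?thesis
    by (rule integrable_lebesgue_AE_cong) (use assms(2) in \<open>auto simp: indicator_def\<close>)
qed

text \<open>One ball of radius \<rho> contains the supports for all times up to \<open>t0\<close>,
  so the cutoff in space can be independent of time. Then the terms with the time derivative of
  \<psi> and with its gradient drop out, and only the damping and the nonlinearity remain.\<close>

lemma energy_solution_mean: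
  fixes u :: "real \<Rightarrow> 'a::euclidean_space \<Rightarrow> real"
  assumes sol: "energy_solution k \<mu> p \<epsilon> u0 u1 T u" and t0: "1 < t0" "ereal t0 < T" and "0 < \<rho>"
    and supp: "\<And>t. t \<in> {1..t0} \<Longrightarrow> AE x in lebesgue. x \<notin> ball 0 \<rho> \<longrightarrow> u t x = 0"
    and u1: "u1 \<in> L2" "AE x in lebesgue. x \<notin> ball 0 \<rho> \<longrightarrow> u1 x = 0"
  obtains V N where
    "\<And>t. t \<in> {1..t0} \<Longrightarrow> ((\<lambda>s. LINT x|lebesgue. u s x) has_real_derivative V t) (at t within {1..t0})"
    "continuous_on {1..t0} V"
    "N absolutely_integrable_on {1..t0}"
    "\<And>s. N s = (LINT x|lebesgue. \<bar>u s x\<bar> powr p)"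
    "AE s in lebesgue. s \<in> {1..t0} \<longrightarrow> integrable lebesgue (\<lambda>x. \<bar>u s x\<bar> powr p)"
    "\<And>t. 1 < t \<Longrightarrow> t \<le> t0 \<Longrightarrow> V t + \<mu> * integral {1..t} (\<lambda>r. V r / r)
      = \<epsilon> * (LINT x|lebesgue. u1 x) + integral {1..t} N"
proof -
  define I where "I = time_interval T"
  have tI: "t \<in> I" if "t \<in> {1..t0}" for t
    using that t0 by (auto simp: I_def time_interval_def intro: le_less_trans[of "ereal t" "ereal t0"])
  then have subI: "{1..t0} \<subseteq> I" by auto
  obtain ut where ut: "C1_L2 I u ut"
    and weak: "\<And>\<psi> t. test_fun ({s. ereal s < T} \<times> UNIV) \<psi> \<Longrightarrow> 1 < t \<Longrightarrow> ereal t < T \<Longrightarrow>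
       (LINT x|lebesgue. ut t x * \<psi> (t, x))
       - \<epsilon> * (LINT x|lebesgue. u1 x * \<psi> (1, x))
       - (LINT s:{1..t}|lebesgue. (LINT x|lebesgue. ut s x * deriv (\<lambda>r. \<psi> (r, x)) s))
       + (LINT s:{1..t}|lebesgue. (LINT x|lebesgue.
            s powr (-2 * k) * (weak_grad (u s) x \<bullet> grad (\<lambda>y. \<psi> (s, y)) x)))
       + (LINT s:{1..t}|lebesgue. (LINT x|lebesgue. \<mu> * s powr (-1) * ut s x * \<psi> (s, x)))
       = (LINT s:{1..t}|lebesgue. (LINT x|lebesgue. \<bar>u s x\<bar> powr p * \<psi> (s, x)))"
    using sol unfolding energy_solution_def I_def by blast
  have uH1: "u t \<in> H1" if "t \<in> I" for t
    using sol that by (auto simp: energy_solution_def C_H1_def I_def)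
  then have uL2: "u t \<in> L2" if "t \<in> I" for t
    using that by (auto simp: H1_def)
  have Lp: "Lp_loc p I u" using sol by (simp add: energy_solution_def I_def)

  \<comment> \<open>The time cutoff has to vanish before \<open>T\<close>, and it has to equal
    \<open>1\<close> strictly beyond \<open>t0\<close>, so that its derivative is zero at
    \<open>t0\<close> as well.\<close>
  obtain r2 where r2: "t0 < r2" "ereal r2 < T"
    using ereal_dense2[OF t0(2)] by auto
  define r1 where "r1 = (t0 + r2) / 2"
  have r1: "0 < r1" "t0 < r1" "r1 < r2" using t0 r2 by (auto simp: r1_def)
  obtain \<eta> :: "real \<Rightarrow> real" where \<eta>: "smooth \<eta>"
    "\<And>s. norm s \<le> r1 \<Longrightarrow> \<eta> s = 1" "\<And>s. r2 \<le> norm s \<Longrightarrow> \<eta> s = 0"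
    using smooth_cutoff[OF r1(1,3)] by metis
  obtain \<zeta> :: "'a \<Rightarrow> real" where \<zeta>: "smooth \<zeta>"
    "\<And>x. norm x \<le> \<rho> \<Longrightarrow> \<zeta> x = 1" "\<And>x. \<rho> + 1 \<le> norm x \<Longrightarrow> \<zeta> x = 0"
    using smooth_cutoff[of \<rho> "\<rho> + 1"] \<open>0 < \<rho>\<close> by (metis less_add_one)
  have \<zeta>_test: "test_fun UNIV \<zeta>"
  proof -
    have "{x. \<zeta> x \<noteq> 0} \<subseteq> cball 0 (\<rho> + 1)" using \<zeta>(3) by force
    then have "bounded {x. \<zeta> x \<noteq> 0}" by (rule bounded_subset[OF bounded_cball])
    then show ?thesis using \<zeta>(1) by (simp add: test_fun_def)
  qed
  have \<zeta>_L2: "\<zeta> \<in> L2" by (rule test_fun_L2[OF \<zeta>_test])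
  define \<psi> where "\<psi> z = \<eta> (fst z) * \<zeta> (snd z)" for z
  have \<psi>_test: "test_fun ({s. ereal s < T} \<times> UNIV) \<psi>"
  proof -
    have "smooth \<psi>"
      unfolding smooth_def \<psi>_def
    proof
      fix m
      have "Ck_times_diff m \<eta>" "Ck_times_diff m \<zeta>" using \<eta>(1) \<zeta>(1) by (auto simp: smooth_def)
      then show "Ck_times_diff m (\<lambda>z. \<eta> (fst z) * \<zeta> (snd z))"
        by (rule Ck_times_diff_mult[OF Ck_times_diff_compose_linear[OF _ bounded_linear_fst]
              Ck_times_diff_compose_linear[OF _ bounded_linear_snd]])
    qed
    moreover define K where "K = cball (0::real) r2 \<times> cball (0::'a) (\<rho> + 1)"
    have "compact K" by (auto simp: K_def intro: compact_Times)
    have "{z. \<psi> z \<noteq> 0} \<subseteq> K"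
      using \<eta>(3) \<zeta>(3) by (force simp: \<psi>_def K_def)
    then have clK: "closure {z. \<psi> z \<noteq> 0} \<subseteq> K"
      using \<open>compact K\<close> by (simp add: closure_minimal compact_imp_closed)
    then have "compact (closure {z. \<psi> z \<noteq> 0})"
      using \<open>compact K\<close> by (metis closed_closure compact_Int_closed inf.absorb_iff2)
    moreover have "K \<subseteq> {s. ereal s < T} \<times> UNIV"
    proof
      fix z assume "z \<in> K"
      then have "ereal (fst z) \<le> ereal r2" by (auto simp: K_def)
      then have "ereal (fst z) < T" using r2(2) by (rule le_less_trans)
      then show "z \<in> {s. ereal s < T} \<times> UNIV" by (cases z) auto
    qed
    ultimately show ?thesis using clK by (auto simp: test_fun_def)
  qed
  have \<psi>_eq: "\<psi> (s, x) = \<zeta> x" if "s \<in> {1..t0}" for s x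
    using that r1 \<eta>(2)[of s] by (simp add: \<psi>_def)
  have cut: "AE x in lebesgue. f x * \<zeta> x = f x"
    if "AE x in lebesgue. x \<notin> ball 0 \<rho> \<longrightarrow> f x = 0" for f
    using that
  proof eventually_elim
    case (elim x)
    then show ?case using \<zeta>(2)[of x] by (cases "x \<in> ball 0 \<rho>") auto
  qed
  have cut_integral: "(LINT x|lebesgue. f x * \<zeta> x) = (LINT x|lebesgue. f x)"
    if "f \<in> borel_measurable lebesgue" "AE x in lebesgue. x \<notin> ball 0 \<rho> \<longrightarrow> f x = 0" for f
    using that cut[OF that(2)] L2_measurable[OF \<zeta>_L2] by (intro integral_cong_AE) auto

  \<comment> \<open>The cutoff stays in \<open>V\<close>, because \<open>ut t\<close> is only known
    to be square integrable and its support has not been located.\<close>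
  define V where "V t = (LINT x|lebesgue. ut t x * \<zeta> x)" for t
  define N where "N s = (LINT x|lebesgue. \<bar>u s x\<bar> powr p)" for s
  have U: "((\<lambda>s. LINT x|lebesgue. u s x) has_real_derivative V t) (at t within {1..t0})"
    if t: "t \<in> {1..t0}" for t
  proof -
    have "((\<lambda>s. LINT x|lebesgue. u s x * \<zeta> x) has_real_derivative V t) (at t within {1..t0})"
      unfolding V_def
      by (rule has_field_derivative_subset[OF C1_L2_pairing_derivative[OF ut \<zeta>_L2 tI[OF t]] subI])
    then show ?thesis
      by (rule has_field_derivative_transform_within[OF _ zero_less_one t])
        (simp only: cut_integral L2_measurable uL2 tI supp)
  qed
  have V_cont: "continuous_on {1..t0} V"
    unfolding V_def using ut \<zeta>_L2 subI
    by (intro continuous_on_subset[OF continuous_on_L2_pairing]) (auto simp: C1_L2_def)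

  \<comment> \<open>This compact set carries all of \<open>\<bar>u\<bar> powr p\<close> up to
    \<open>t0\<close>, up to null sets in each slice, so local integrability in space-time turns
    into integrability of \<open>N\<close> in time.\<close>
  define K where "K = {1..t0} \<times> cball (0::'a) \<rho>"
  have "compact K" by (auto simp: K_def intro: compact_Times)
  moreover have "K \<subseteq> I \<times> UNIV" using subI by (auto simp: K_def)
  ultimately have "integrable (lebesgue_on K) (\<lambda>(t, x). \<bar>u t x\<bar> powr p)"
    using Lp by (auto simp: Lp_loc_def)
  then have "integrable lebesgue (\<lambda>z. indicator K z *\<^sub>R (case z of (t, x) \<Rightarrow> \<bar>u t x\<bar> powr p))"
    using \<open>compact K\<close> by (subst (asm) integrable_restrict_space) (auto intro: lmeasurable_compact fmeasurableD)
  note fub = lebesgue_Fubini[OF this]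
  have slice: "AE x in lebesgue. indicator K (s, x) *\<^sub>R (\<bar>u s x\<bar> powr p) = \<bar>u s x\<bar> powr p"
    if "s \<in> {1..t0}" for s
    using supp[OF that] by eventually_elim (use that in \<open>auto simp: K_def indicator_def\<close>)
  have slice_integral: "indicator {1..t0} s * N s = (LINT x|lebesgue. indicator K (s, x) *\<^sub>R (\<bar>u s x\<bar> powr p))" for s
  proof (cases "s \<in> {1..t0}")
    case True
    have m: "(\<lambda>x. \<bar>u s x\<bar> powr p) \<in> borel_measurable lebesgue"
      using L2_measurable[OF uL2[OF tI[OF True]]] by measurable
    have "AE x in lebesgue. \<bar>u s x\<bar> powr p = indicator K (s, x) *\<^sub>R (\<bar>u s x\<bar> powr p)"
      using slice[OF True] by eventually_elim simp
    then have "(LINT x|lebesgue. \<bar>u s x\<bar> powr p) = (LINT x|lebesgue. indicator K (s, x) *\<^sub>R (\<bar>u s x\<bar> powr p))"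
      by (intro integral_cong_AE m borel_measurable_lebesgue_AE[OF m])
    then show ?thesis using True by (simp add: N_def)
  next
    case False
    then have "indicator K (s, x) = (0::real)" for x by (auto simp: K_def indicator_def)
    with False show ?thesis by simp
  qed
  have N_int: "N absolutely_integrable_on {1..t0}"
    using fub(2) slice_integral by (simp add: set_integrable_def)
  have slices: "AE s in lebesgue. s \<in> {1..t0} \<longrightarrow> integrable lebesgue (\<lambda>x. \<bar>u s x\<bar> powr p)"
    using fub(1)
  proof eventually_elim
    case (elim s)
    then show ?case using slice[of s] by (auto intro: integrable_lebesgue_AE_cong)
  qed

  have "V t + \<mu> * integral {1..t} (\<lambda>r. V r / r) = \<epsilon> * (LINT x|lebesgue. u1 x) + integral {1..t} N"
    if t: "1 < t" "t \<le> t0" for t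
  proof -
    have tT: "ereal t < T" using t t0 by (intro le_less_trans[of "ereal t" "ereal t0"]) auto
    have sub_t: "{1..t} \<subseteq> {1..t0}" using t by auto
    have zero: "(LINT s:{1..t}|lebesgue. F s) = 0" if "\<And>s. s \<in> {1..t} \<Longrightarrow> F s = 0" for F :: "real \<Rightarrow> real"
    proof -
      have "(\<lambda>s. indicator {1..t} s *\<^sub>R F s) = (\<lambda>s. 0)" using that by (auto simp: indicator_def)
      then show ?thesis by (simp add: set_lebesgue_integral_def)
    qed
    have "deriv (\<lambda>r. \<psi> (r, x)) s = 0" if "s \<in> {1..t}" for s x
    proof (rule DERIV_imp_deriv)
      have "((\<lambda>r. \<zeta> x) has_real_derivative 0) (at s)" by simp
      then show "((\<lambda>r. \<psi> (r, x)) has_real_derivative 0) (at s)"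
        by (rule has_field_derivative_transform_within_open[where S = "ball 0 r1"])
          (use that t r1 \<eta>(2) in \<open>auto simp: \<psi>_def\<close>)
    qed
    then have e3: "(LINT s:{1..t}|lebesgue. (LINT x|lebesgue. ut s x * deriv (\<lambda>r. \<psi> (r, x)) s)) = 0"
      by (intro zero) simp
    have e4: "(LINT s:{1..t}|lebesgue. (LINT x|lebesgue.
            s powr (-2 * k) * (weak_grad (u s) x \<bullet> grad (\<lambda>y. \<psi> (s, y)) x))) = 0"
    proof (rule zero)
      fix s assume "s \<in> {1..t}"
      then have s: "s \<in> {1..t0}" using t by auto
      have "(\<lambda>y. \<psi> (s, y)) = \<zeta>" using \<psi>_eq[OF s] by auto
      moreover have "(LINT x|lebesgue. weak_grad (u s) x \<bullet> grad \<zeta> x) = 0"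
        using \<zeta>(2) by (intro integral_weak_grad_cutoff_zero[where S = "ball 0 \<rho>"] uH1 tI s \<zeta>_test supp) auto
      ultimately show "(LINT x|lebesgue. s powr (-2 * k) * (weak_grad (u s) x \<bullet> grad (\<lambda>y. \<psi> (s, y)) x)) = 0"
        by simp
    qed
    have "(LINT s:{1..t}|lebesgue. (LINT x|lebesgue. \<mu> * s powr (-1) * ut s x * \<psi> (s, x)))
        = (LINT s:{1..t}|lebesgue. \<mu> * (V s / s))"
    proof (rule set_lebesgue_integral_cong)
      show "\<forall>s. s \<in> {1..t} \<longrightarrow> (LINT x|lebesgue. \<mu> * s powr (-1) * ut s x * \<psi> (s, x)) = \<mu> * (V s / s)"
      proof (intro allI impI)
        fix s assume s: "s \<in> {1..t}"
        then have "(LINT x|lebesgue. \<mu> * s powr (-1) * ut s x * \<psi> (s, x))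
            = (LINT x|lebesgue. \<mu> * s powr (-1) * (ut s x * \<zeta> x))"
          using sub_t by (intro Bochner_Integration.integral_cong) (auto simp: \<psi>_eq)
        then show "(LINT x|lebesgue. \<mu> * s powr (-1) * ut s x * \<psi> (s, x)) = \<mu> * (V s / s)"
          using s by (simp add: V_def powr_minus divide_inverse)
      qed
    qed auto
    also have "\<dots> = integral {1..t} (\<lambda>s. \<mu> * (V s / s))"
      by (intro set_lebesgue_integral_eq_integral absolutely_integrable_continuous_real
          continuous_intros continuous_on_subset[OF V_cont sub_t]) auto
    finally have e5: "(LINT s:{1..t}|lebesgue. (LINT x|lebesgue. \<mu> * s powr (-1) * ut s x * \<psi> (s, x)))
        = \<mu> * integral {1..t} (\<lambda>s. V s / s)"
      unfolding integral_mult_right .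
    have "(LINT s:{1..t}|lebesgue. (LINT x|lebesgue. \<bar>u s x\<bar> powr p * \<psi> (s, x))) = (LINT s:{1..t}|lebesgue. N s)"
    proof (rule set_lebesgue_integral_cong)
      show "\<forall>s. s \<in> {1..t} \<longrightarrow> (LINT x|lebesgue. \<bar>u s x\<bar> powr p * \<psi> (s, x)) = N s"
      proof (intro allI impI)
        fix s assume "s \<in> {1..t}"
        then have s: "s \<in> {1..t0}" using t by auto
        have "(\<lambda>x. \<bar>u s x\<bar> powr p) \<in> borel_measurable lebesgue"
          using L2_measurable[OF uL2[OF tI[OF s]]] by measurable
        moreover have "AE x in lebesgue. x \<notin> ball 0 \<rho> \<longrightarrow> \<bar>u s x\<bar> powr p = 0"
          using supp[OF s] by eventually_elim auto
        ultimately show "(LINT x|lebesgue. \<bar>u s x\<bar> powr p * \<psi> (s, x)) = N s"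
          unfolding N_def \<psi>_eq[OF s] by (rule cut_integral)
      qed
    qed auto
    also have "\<dots> = integral {1..t} N"
      using N_int sub_t by (intro set_lebesgue_integral_eq_integral absolutely_integrable_on_subinterval[OF N_int]) auto
    finally have e6: "(LINT s:{1..t}|lebesgue. (LINT x|lebesgue. \<bar>u s x\<bar> powr p * \<psi> (s, x))) = integral {1..t} N" .
    have e1: "(LINT x|lebesgue. ut t x * \<psi> (t, x)) = V t"
      using t by (simp add: \<psi>_eq V_def)
    have e2: "(LINT x|lebesgue. u1 x * \<psi> (1, x)) = (LINT x|lebesgue. u1 x)"
      using t0 u1 by (simp add: \<psi>_eq cut_integral L2_measurable)
    show ?thesis
      using weak[OF \<psi>_test t(1) tT] unfolding e1 e2 e3 e4 e5 e6 by linarith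
  qed
  with U V_cont N_int slices show ?thesis by (intro that[of V N]) (auto simp: N_def)
qed

section \<open>Blow-up in the critical case\<close>

lemma A_fun_eq:
  assumes "k < 1" "1 \<le> t"
  shows "A_fun k t = (t powr (1 - k) - 1) / (1 - k)"
proof -
  have "((\<lambda>\<tau>. \<tau> powr (- k)) has_integral t powr (1 - k) / (1 - k) - 1 powr (1 - k) / (1 - k)) {1..t}"
  proof (rule fundamental_theorem_of_calculus)
    fix x assume x: "x \<in> {1..t}"
    have "((\<lambda>\<tau>. \<tau> powr (1 - k) / (1 - k)) has_real_derivative (1 - k) * x powr (1 - k - 1) / (1 - k)) (at x)"
      using x by (intro DERIV_cdivide has_real_derivative_powr) auto
    then show "((\<lambda>\<tau>. \<tau> powr (1 - k) / (1 - k)) has_vector_derivative x powr (- k)) (at x within {1..t})"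
      using assms by (simp add: has_real_derivative_iff_has_vector_derivative has_vector_derivative_at_within)
  qed (use assms in simp)
  then show ?thesis by (simp add: A_fun_def integral_unique diff_divide_distrib)
qed

text \<open>With \<open>x = (1 - k) n\<close> the numerator exceeds the denominator
  \<open>x + 2\<close> by \<open>x^2 + 2 k x\<close>.\<close>

lemma mu0_gt_one: "0 \<le> k \<Longrightarrow> k < 1 \<Longrightarrow> 0 < n \<Longrightarrow> 1 < mu0 k n"
proof -
  assume k: "0 \<le> k" "k < 1" and n: "0 < n"
  define x where "x = (1 - k) * real n"
  have "0 < x" using k n by (simp add: x_def)
  then have "x + 2 < x\<^sup>2 + (1 + 2 * k) * x + 2" using k by (simp add: add_pos_nonneg distrib_right)
  then have "1 < (x\<^sup>2 + (1 + 2 * k) * x + 2) / (x + 2)" using \<open>0 < x\<close> by simp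
  moreover have "mu0 k n = (x\<^sup>2 + (1 + 2 * k) * x + 2) / (x + 2)"
    by (simp add: mu0_def x_def power_mult_distrib mult_ac)
  ultimately show "1 < mu0 k n" by simp
qed

text \<open>The exponent \<^term>\<open>p1 k n\<close> is chosen to make the power of \<open>t\<close> equal to \<open>-2\<close>.\<close>

lemma light_cone_volume_powr:
  assumes "k < 1" "0 < R"
  obtains c where "0 < c" "\<And>t. 1 \<le> t \<Longrightarrow>
    c / t\<^sup>2 \<le> measure lebesgue (ball (0::'a::euclidean_space) (A_fun k t + R)) powr (1 - p1 k DIM('a))"
proof -
  \<comment> \<open>For \<open>t \<ge> 1\<close>, \<open>A_fun k t + R\<close> is at most
    \<open>M * t powr (1 - k)\<close>. The exponent \<open>q\<close> is negative, so an upper bound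
    on the volume becomes a lower bound on its power.\<close>
  define M \<omega> q where "M = 1 / (1 - k) + R" and "\<omega> = unit_ball_vol (real DIM('a))"
    and "q = 1 - p1 k DIM('a)"
  have M: "0 < M" using assms by (auto simp: M_def intro: add_pos_pos)
  have \<omega>: "0 < \<omega>" by (simp add: \<omega>_def)
  have q: "q < 0" "(1 - k) * real DIM('a) * q = - 2"
    using assms by (auto simp: q_def p1_def)
  show ?thesis
  proof (rule that[of "(\<omega> * M ^ DIM('a)) powr q"])
    show "0 < (\<omega> * M ^ DIM('a)) powr q" using \<omega> M by simp
    fix t :: real assume t: "1 \<le> t"
    define y where "y = t powr (1 - k)"
    have "1 powr (1 - k) \<le> y" unfolding y_def using t assms by (intro powr_mono2) auto
    then have y: "1 \<le> y" by simp
    have r: "0 < A_fun k t + R"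
      using y assms t by (auto simp: A_fun_eq y_def[symmetric] intro: add_nonneg_pos)
    have "(y - 1) / (1 - k) \<le> y / (1 - k)" using assms by (intro divide_right_mono) auto
    moreover have "R \<le> R * y" using y assms by simp
    moreover have "A_fun k t = (y - 1) / (1 - k)" "M * y = y / (1 - k) + R * y"
      using t assms by (simp_all add: A_fun_eq y_def M_def distrib_right)
    ultimately have "A_fun k t + R \<le> M * y" by linarith
    then have "(A_fun k t + R) ^ DIM('a) \<le> (M * y) ^ DIM('a)" using r by (intro power_mono) auto
    then have vol: "measure lebesgue (ball (0::'a) (A_fun k t + R)) \<le> \<omega> * (M * y) ^ DIM('a)"
      using r \<omega> by (simp add: content_ball \<omega>_def)
    have "(\<omega> * (M * y) ^ DIM('a)) powr q = (\<omega> * M ^ DIM('a)) powr q * (y ^ DIM('a)) powr q"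
      using \<omega> M y by (simp add: power_mult_distrib powr_mult)
    also have "(y ^ DIM('a)) powr q = t powr ((1 - k) * real DIM('a) * q)"
      using t y by (simp add: y_def powr_realpow[symmetric] powr_powr)
    also have "\<dots> = 1 / t\<^sup>2" using t unfolding q(2) by (simp add: powr_minus_divide)
    finally have "(\<omega> * M ^ DIM('a)) powr q / t\<^sup>2 = (\<omega> * (M * y) ^ DIM('a)) powr q" by simp
    also have "\<dots> \<le> measure lebesgue (ball (0::'a) (A_fun k t + R)) powr q"
      using vol q(1) r by (intro powr_mono2') auto
    finally show "(\<omega> * M ^ DIM('a)) powr q / t\<^sup>2
      \<le> measure lebesgue (ball (0::'a) (A_fun k t + R)) powr (1 - p1 k DIM('a))"
      by (simp add: q_def)
  qed
qed

theorem theorem1p4: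
  fixes u0 u1 :: "real ^ 'n \<Rightarrow> real" and k \<mu> p R :: real
  assumes "0 \<le> k" and "k < 1"
    and "\<mu> \<ge> mu0 k CARD('n)"
    and "p = p1 k CARD('n)"
    and "R > 0"
    and "u0 \<in> H1" and "u1 \<in> L2"
    and "AE x in lebesgue. 0 \<le> u0 x" and "AE x in lebesgue. 0 \<le> u1 x"
    and "\<not> (AE x in lebesgue. u0 x = 0)" and "\<not> (AE x in lebesgue. u1 x = 0)"
    and "compact (ess_supp u0)" and "compact (ess_supp u1)"
    and "ess_supp u0 \<subseteq> ball 0 R" and "ess_supp u1 \<subseteq> ball 0 R"
  shows "\<exists>\<epsilon>0>0. \<exists>C>0. \<forall>\<epsilon>. 0 < \<epsilon> \<and> \<epsilon> \<le> \<epsilon>0 \<longrightarrow>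
           (\<forall>T (u :: real \<Rightarrow> real ^ 'n \<Rightarrow> real).
              has_lifespan k \<mu> p \<epsilon> u0 u1 u T \<and>
              (\<forall>t. 1 < t \<and> ereal t < T \<longrightarrow> ess_supp (u t) \<subseteq> ball 0 (A_fun k t + R))
              \<longrightarrow> T < \<infinity> \<and> T \<le> ereal (exp (C * \<epsilon> powr (- (p - 1)))))"
proof -
  have \<mu>: "1 < \<mu>" using mu0_gt_one[of k "CARD('n)"] assms(1-3) by simp
  have p: "1 < p" using assms(2,4) by (simp add: p1_def)
  have u0: "u0 \<in> L2" using assms(6) by (simp add: H1_def)
  have supp0: "AE x in lebesgue. x \<notin> ball 0 R \<longrightarrow> u0 x = 0"
    and supp1: "AE x in lebesgue. x \<notin> ball 0 R \<longrightarrow> u1 x = 0"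
    by (rule AE_zero_outside_ess_supp, fact)+
  define I0 I1 where "I0 = (LINT x|lebesgue. u0 x)" and "I1 = (LINT x|lebesgue. u1 x)"
  have pos: "0 < (LINT x|lebesgue. f x)"
    if "f \<in> L2" "AE x in lebesgue. x \<notin> ball 0 R \<longrightarrow> f x = 0" "AE x in lebesgue. 0 \<le> f x"
      "\<not> (AE x in lebesgue. f x = 0)" for f :: "real ^ 'n \<Rightarrow> real"
    using integral_nonneg_eq_0_iff_AE[OF integrable_L2_bounded_support[OF that(1,2)] that(3)]
      integral_nonneg_AE[OF that(3)] that(4) by linarith
  have I: "0 < I0" "0 < I1"
    unfolding I0_def I1_def using u0 supp0 supp1 assms by (auto intro!: pos)
  obtain c where c: "0 < c" "\<And>t. 1 \<le> t \<Longrightarrow>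
    c / t\<^sup>2 \<le> measure lebesgue (ball (0::real^'n) (A_fun k t + R)) powr (1 - p)"
    using light_cone_volume_powr[where 'a = "real^'n", OF assms(2,5)] assms(4) by auto
  obtain C where C: "0 < C" "\<And>\<epsilon> U V. 0 < \<epsilon> \<Longrightarrow> \<epsilon> \<le> 1 \<Longrightarrow> \<epsilon> * I0 \<le> U 1 \<Longrightarrow> \<epsilon> * I1 \<le> V 1 \<Longrightarrow>
      \<not> damped_supersolution \<mu> c p (exp (C * \<epsilon> powr (- (p - 1)))) U V"
    by (rule damped_blow_up[OF \<mu> c(1) p I]) blast
  have bound: "T \<le> ereal (exp (C * \<epsilon> powr (- (p - 1))))"
    if \<epsilon>: "0 < \<epsilon>" "\<epsilon> \<le> 1" and sol: "energy_solution k \<mu> p \<epsilon> u0 u1 T u"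
      and cone: "\<And>t. 1 < t \<Longrightarrow> ereal t < T \<Longrightarrow> ess_supp (u t) \<subseteq> ball 0 (A_fun k t + R)"
    for \<epsilon> T and u :: "real \<Rightarrow> real ^ 'n \<Rightarrow> real"
  proof (rule ccontr)
    define t0 where "t0 = exp (C * \<epsilon> powr (- (p - 1)))"
    assume "\<not> T \<le> ereal (exp (C * \<epsilon> powr (- (p - 1))))"
    then have t0T: "ereal t0 < T" by (simp add: t0_def)
    have t0: "1 < t0" using C(1) \<epsilon> by (simp add: t0_def)
    have tT: "ereal t < T" if "t \<le> t0" for t using that t0T by (auto intro: le_less_trans[of "ereal t" "ereal t0"])
    have uL2: "u t \<in> L2" if "t \<in> {1..t0}" for t
      using sol that tT by (auto simp: energy_solution_def C_H1_def time_interval_def H1_def)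
    have u_init: "AE x in lebesgue. u 1 x = \<epsilon> * u0 x" using sol by (simp add: energy_solution_def)
    \<comment> \<open>The cone condition is assumed after time \<open>1\<close> only; at time
      \<open>1\<close> the support comes from the initial datum, the radius being \<open>R\<close>
      since \<open>A_fun k 1 = 0\<close>.\<close>
    have supp: "AE x in lebesgue. x \<notin> ball 0 (A_fun k t + R) \<longrightarrow> u t x = 0" if "t \<in> {1..t0}" for t
    proof (cases "t = 1")
      case True
      show ?thesis using supp0 u_init
        by eventually_elim (use True in \<open>auto simp: A_fun_def\<close>)
    next
      case False
      then show ?thesis using that tT by (intro AE_zero_outside_ess_supp cone) auto
    qed
    \<comment> \<open>The radius of the cone at the final time serves the cutoff only; the lower
      bound on \<open>N\<close> uses the ball at time \<open>s\<close>, whose volume supplies the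
      factor \<open>1 / s\<^sup>2\<close>.\<close>
    define \<rho> where "\<rho> = A_fun k t0 + R"
    have mono: "A_fun k s + R \<le> \<rho>" if "s \<in> {1..t0}" for s
      using that assms(2) t0 by (auto simp: \<rho>_def A_fun_eq intro!: divide_right_mono powr_mono2)
    have "A_fun k 1 = 0" by (simp add: A_fun_def)
    then have \<rho>: "R \<le> \<rho>" using mono[of 1] t0 by simp
    have supp_\<rho>: "AE x in lebesgue. x \<notin> ball 0 \<rho> \<longrightarrow> u t x = 0" if "t \<in> {1..t0}" for t
      using supp[OF that] by eventually_elim (use mono[OF that] in auto)
    have supp1_\<rho>: "AE x in lebesgue. x \<notin> ball 0 \<rho> \<longrightarrow> u1 x = 0"
      using supp1 by eventually_elim (use \<rho> in auto)
    have "0 < \<rho>" using \<rho> assms(5) by simp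
    show False
    proof (rule energy_solution_mean[OF sol t0 t0T \<open>0 < \<rho>\<close> supp_\<rho> assms(7) supp1_\<rho>])
      fix V N
      assume U: "\<And>t. t \<in> {1..t0} \<Longrightarrow> ((\<lambda>s. LINT x|lebesgue. u s x) has_real_derivative V t) (at t within {1..t0})"
        and V: "continuous_on {1..t0} V"
        and N: "N absolutely_integrable_on {1..t0}"
        and N_eq: "\<And>s. N s = (LINT x|lebesgue. \<bar>u s x\<bar> powr p)"
        and slices: "AE s in lebesgue. s \<in> {1..t0} \<longrightarrow> integrable lebesgue (\<lambda>x. \<bar>u s x\<bar> powr p)"
        and "\<And>t. 1 < t \<Longrightarrow> t \<le> t0 \<Longrightarrow> V t + \<mu> * integral {1..t} (\<lambda>r. V r / r)
          = \<epsilon> * (LINT x|lebesgue. u1 x) + integral {1..t} N"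
      then have identity: "\<And>t. 1 < t \<Longrightarrow> t \<le> t0 \<Longrightarrow>
          V t + \<mu> * integral {1..t} (\<lambda>r. V r / r) = \<epsilon> * I1 + integral {1..t} N"
        by (simp add: I1_def)
      define U where "U = (\<lambda>s. LINT x|lebesgue. u s x)"
      note U = U[folded U_def]
      have U_cont: "continuous_on {1..t0} U" by (rule DERIV_continuous_on[OF U])
      have Vr: "(\<lambda>r. V r / r) integrable_on {1..t0}"
        using V by (intro integrable_continuous_real continuous_intros) auto
      have N_lower: "AE s in lebesgue. s \<in> {1..t0} \<longrightarrow> c / s\<^sup>2 * \<bar>U s\<bar> powr p \<le> N s"
        using slices
      proof eventually_elim
        case (elim s)
        show ?case
        proof
          assume s: "s \<in> {1..t0}"
          have "0 \<le> A_fun k s" using s assms(1,2) by (auto simp: A_fun_eq intro!: divide_nonneg_pos ge_one_powr_ge_zero)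
          then have "0 < A_fun k s + R" using assms(5) by simp
          then have "measure lebesgue (ball (0::real^'n) (A_fun k s + R)) powr (1 - p) * \<bar>U s\<bar> powr p \<le> N s"
            unfolding U_def N_eq using elim s
            by (intro powr_integral_le_on_support p supp integrable_L2_bounded_support[OF uL2 supp]) auto
          moreover have "c / s\<^sup>2 * \<bar>U s\<bar> powr p
              \<le> measure lebesgue (ball (0::real^'n) (A_fun k s + R)) powr (1 - p) * \<bar>U s\<bar> powr p"
            using s by (intro mult_right_mono c(2)) auto
          ultimately show "c / s\<^sup>2 * \<bar>U s\<bar> powr p \<le> N s" by linarith
        qed
      qed
      \<comment> \<open>The identities at \<open>s\<close> and \<open>t\<close> are subtracted,
        which cancels the datum; the lower bound on \<open>N\<close> need hold only almost
        everywhere under the integral.\<close>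
      have super: "integral {s..t} (\<lambda>r. c / r\<^sup>2 * \<bar>U r\<bar> powr p) \<le> V t - V s + \<mu> * integral {s..t} (\<lambda>r. V r / r)"
        if st: "1 < s" "s < t" "t < t0" for s t
      proof -
        have sub: "{s..t} \<subseteq> {1..t0}" "{1..t} \<subseteq> {1..t0}" using st by auto
        have Nst: "N absolutely_integrable_on {s..t}"
          using N sub(1) by (rule absolutely_integrable_on_subinterval)
        have Ust: "(\<lambda>r. c / r\<^sup>2 * \<bar>U r\<bar> powr p) absolutely_integrable_on {s..t}"
          using st p by (intro absolutely_integrable_continuous_real continuous_intros continuous_on_powr'
              continuous_on_subset[OF U_cont sub(1)]) auto
        have "AE r\<in>{s..t} in lebesgue. c / r\<^sup>2 * \<bar>U r\<bar> powr p \<le> N r"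
          using N_lower by eventually_elim (use sub in auto)
        then have "(LINT r:{s..t}|lebesgue. c / r\<^sup>2 * \<bar>U r\<bar> powr p) \<le> (LINT r:{s..t}|lebesgue. N r)"
          by (intro set_integral_mono_AE Ust Nst)
        then have "integral {s..t} (\<lambda>r. c / r\<^sup>2 * \<bar>U r\<bar> powr p) \<le> integral {s..t} N"
          unfolding set_lebesgue_integral_eq_integral(2)[OF Nst] set_lebesgue_integral_eq_integral(2)[OF Ust] .
        moreover have "integral {1..s} N + integral {s..t} N = integral {1..t} N"
          using st sub by (intro Henstock_Kurzweil_Integration.integral_combine
              integrable_on_subinterval[OF set_lebesgue_integral_eq_integral(1)[OF N]]) auto
        moreover have "integral {1..s} (\<lambda>r. V r / r) + integral {s..t} (\<lambda>r. V r / r) = integral {1..t} (\<lambda>r. V r / r)"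
          using st sub by (intro Henstock_Kurzweil_Integration.integral_combine integrable_on_subinterval[OF Vr]) auto
        then have "\<mu> * integral {1..s} (\<lambda>r. V r / r) + \<mu> * integral {s..t} (\<lambda>r. V r / r)
            = \<mu> * integral {1..t} (\<lambda>r. V r / r)"
          by (metis distrib_left)
        ultimately show ?thesis
          using identity[of s] identity[of t] st by linarith
      qed
      have "U 1 = (LINT x|lebesgue. \<epsilon> * u0 x)"
        unfolding U_def using u_init L2_measurable[OF uL2[of 1]] L2_measurable[OF u0] t0
        by (intro integral_cong_AE) auto
      then have U1: "\<epsilon> * I0 \<le> U 1" by (simp add: I0_def)
      \<comment> \<open>The identity holds for \<open>t > 1\<close>. Dropping the nonnegative
        integral of \<open>N\<close> and letting \<open>t\<close> tend to \<open>1\<close> gives the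
        initial slope by continuity.\<close>
      have "\<epsilon> * I1 \<le> V 1 + \<mu> * integral {1..1} (\<lambda>r. V r / r)"
      proof (rule continuous_ge_on_closure[where S = "{1<..t0}" and x = 1
            and f = "\<lambda>t. V t + \<mu> * integral {1..t} (\<lambda>r. V r / r)"])
        show "continuous_on (closure {1<..t0}) (\<lambda>t. V t + \<mu> * integral {1..t} (\<lambda>r. V r / r))"
          using t0 V by (auto intro!: continuous_intros indefinite_integral_continuous_1 Vr)
        show "1 \<in> closure {1<..t0}" using t0 by simp
        fix t assume t: "t \<in> {1<..t0}"
        have "0 \<le> integral {1..t} N"
          using t by (intro integral_nonneg integrable_on_subinterval[OF set_lebesgue_integral_eq_integral(1)[OF N]])
            (auto simp: N_eq)
        then show "\<epsilon> * I1 \<le> V t + \<mu> * integral {1..t} (\<lambda>r. V r / r)" using identity[of t] t by simp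
      qed
      then have V1: "\<epsilon> * I1 \<le> V 1" by simp
      have "damped_supersolution \<mu> c p t0 U V"
        using U V super by (simp add: damped_supersolution_def)
      with C(2)[of \<epsilon> U V] \<epsilon> U1 V1 show False by (simp add: t0_def)
    qed
  qed
  show ?thesis
  proof (intro exI conjI allI impI; (elim conjE)?)
    \<comment> \<open>\<epsilon>0 is \<open>1\<close>: the bound on the lifespan was derived for
      every positive \<epsilon> up to \<open>1\<close>.\<close>
    show "(0::real) < 1" by simp
    show "0 < C" by (rule C(1))
    fix \<epsilon> T and u :: "real \<Rightarrow> real ^ 'n \<Rightarrow> real"
    assume \<epsilon>: "0 < \<epsilon>" "\<epsilon> \<le> 1" and life: "has_lifespan k \<mu> p \<epsilon> u0 u1 u T"
      and cone: "\<forall>t. 1 < t \<and> ereal t < T \<longrightarrow> ess_supp (u t) \<subseteq> ball 0 (A_fun k t + R)"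
    show "T \<le> ereal (exp (C * \<epsilon> powr (- (p - 1))))"
      using life cone by (intro bound[OF \<epsilon>]) (auto simp: has_lifespan_def)
    then show "T < \<infinity>" by (rule le_less_trans) simp
  qed
qed

end
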